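(* Let $Q_1,Q_2$ be ground quantum types and suppose $\Vdash\{b_1\mapsto e_1\mid\dots\mid b_n\mapsto e_n\}:U(Q_1,Q_2)$ is derivable. Then its interpretation $$[\![\{b_1\mapsto e_1\mid\dots\mid b_n\mapsto e_n\}]\!]=\sum_{i\le n}[\![\Gamma_i\vdash e_i:Q_2]\!]\circ[\![\Gamma_i\vdash b_i:Q_1]\!]^*\;:\;[\![Q_1]\!]\to[\![Q_2]\!]$$ is a unitary operator.
   Context: **Syntax.** Ground quantum types: $Q::=I\mid Q\oplus Q\mid Q\otimes Q\mid\mathrm{qnat}$. Let $x$ range over variables and $\alpha$ over complex scalars; all index sets are finite. Basis values: $b::=*\mid x\mid\mathrm{inl}\,b\mid\mathrm{inr}\,b\mid b\otimes b\mid 0\mid S\,b$. Expressions: $e::=*\mid x\mid\mathrm{inl}\,e\mid\mathrm{inr}\,e\mid e\otimes e\mid 0\mid S\,e\mid\sum_{i\in I}(\alpha_i\cdot e_i)$. **Orthogonality** $\perp$ (on expressions) is the smallest symmetric relation such that: $\mathrm{inl}\,t_1\perp\mathrm{inr}\,t_2$; $0\perp S\,t$; if $t_1\perp t_2$ then $S\,t_1\perp S\,t_2$, $\mathrm{inl}\,t_1\perp\mathrm{inl}\,t_2$, $\mathrm{inr}\,t_1\perp\mathrm{inr}\,t_2$, and, for all $t,t'$, $t\otimes t_1\perp t'\otimes t_2$ and $t_1\otimes t\perp t_2\otimes t'$; if $t\perp t_i$ for all $i\in I$ then $t\perp\sum_{i\in I}(\alpha_i\cdot t_i)$; if $t\perp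 t_i$ for all $i\in I$, $\alpha_\star=0$ and $t_\star=t$, then $t\perp\sum_{i\in I\cup\{\star\}}(\alpha_i\cdot t_i)$; if $t_i\perp t_j$ for all $i\ne j\in I$, $J,K\subseteq I$ and $\sum_{i\in J\cap K}\overline{\alpha_i}\beta_i=0$, then $\sum_{j\in J}(\alpha_j\cdot t_j)\perp\sum_{k\in K}(\beta_k\cdot t_k)$. **Orthonormal bases.** For a set $S$ of elements of the form $b\otimes b'$, $\pi_1(S),\pi_2(S)$ are the sets of first, resp. second, components, $S^1_b=\{b'\mid b\otimes b'\in S\}$ and $S^2_b=\{b'\mid b'\otimes b\in S\}$. $\mathrm{ONB}_Q$ is the smallest predicate on finite sets of basis values with: $\mathrm{ONB}_Q(\{x\})$; $\mathrm{ONB}_I(\{*\})$; if $\mathrm{ONB}_{Q_1}(S)$ and $\mathrm{ONB}_{Q_2}(T)$ then $\mathrm{ONB}_{Q_1\oplus Q_2}(\{\mathrm{inl}\,b\mid b\in S\}\cup\{\mathrm{inr}\,b\mid b\in T\})$; if $\mathrm{ONB}_{\mathrm{qnat}}(S)$ then $\mathrm{ONB}_{\mathrm{qnat}}(\{0\}\cup\{S\,b\mid b\in S\})$; $\mathrm{ONB}_{Q_1\otimes Q_2}(S)$ if $\mathrm{ONB}_{Q_2}(\pi_2(S))$ and $\mathrm{ONB}_{Q_1}(S^2_b)$ for all $b\in\pi_2(S)$; $\mathrm{ONB}_{Q_1\otimes Q_2}(S)$ if $\mathrm{ONB}_{Q_1}(\pi_1(S))$ and $\mathrm{ONB}_{Q_2}(S^1_b)$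 for all $b\in\pi_1(S)$. $\mathrm{ONB}^e_Q$ is the predicate on finite sets of expressions generated by the same rules (for expressions) together with: if $\mathrm{ONB}^e_Q(S)$ and $(\alpha_{e,e'})_{(e,e')\in S\times S}$ is a unitary matrix then $\mathrm{ONB}^e_Q(\{\sum_{e'\in S}(\alpha_{e,e'}\cdot e')\mid e\in S\})$. **Typing** (contexts $\Gamma$ are finite sets of pairs $x:Q$, used strictly linearly; comma is disjoint union). $\vdash *:I$; $x:Q\vdash x:Q$; $\Gamma_1,\Gamma_2\vdash e_1\otimes e_2:Q_1\otimes Q_2$ if $\Gamma_i\vdash e_i:Q_i$; $\Gamma\vdash\mathrm{inl}\,e:Q_1\oplus Q_2$ if $\Gamma\vdash e:Q_1$; $\Gamma\vdash\mathrm{inr}\,e:Q_1\oplus Q_2$ if $\Gamma\vdash e:Q_2$; $\vdash 0:\mathrm{qnat}$; $\Gamma\vdash S\,e:\mathrm{qnat}$ if $\Gamma\vdash e:\mathrm{qnat}$; $\Gamma\vdash\sum_i(\alpha_i\cdot e_i):Q$ if $\Gamma\vdash e_i:Q$ for all $i$, $\sum_i|\alpha_i|^2=1$ and $e_i\perp e_j$ for $i\neq j$. The judgement $\Vdash\{b_1\mapsto e_1\mid\dots\mid b_n\mapsto e_n\}:U(Q_1,Q_2)$ is derivable when there are contexts $\Gamma_i$ with $\Gamma_i\vdash b_i:Q_1$ and $\Gamma_i\vdash e_i:Q_2$ for all $i$, and $\mathrm{ONB}_{Q_1}(\{b_1,\dots,b_n\})$ and $\mathrm{ONB}^e_{Q_2}(\{e_1,\dots,e_n\})$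 hold (the $b_i$ being pairwise distinct and the $e_i$ pairwise distinct). **Denotations** in countably-dimensional complex Hilbert spaces. $[\![I]\!]=\mathbb C$, $[\![Q_1\oplus Q_2]\!]=[\![Q_1]\!]\oplus[\![Q_2]\!]$, $[\![Q_1\otimes Q_2]\!]=[\![Q_1]\!]\otimes[\![Q_2]\!]$, $[\![\mathrm{qnat}]\!]=\ell^2(\mathbb N)$; a context is interpreted as the tensor product of its types (up to canonical permutations). $[\![\Gamma\vdash e:Q]\!]:[\![\Gamma]\!]\to[\![Q]\!]$ is: $[\![*]\!]=\mathrm{id}_{\mathbb C}$, $[\![x]\!]=\mathrm{id}$, $[\![\mathrm{inl}\,e]\!]=\iota_l\circ[\![e]\!]$, $[\![\mathrm{inr}\,e]\!]=\iota_r\circ[\![e]\!]$ (direct-sum injections), $[\![e\otimes e']\!]=[\![e]\!]\otimes[\![e']\!]$, $[\![0]\!]=|0\rangle$, $[\![S\,e]\!]=\mathrm{succ}\circ[\![e]\!]$ with $\mathrm{succ}|n\rangle=|n+1\rangle$, $[\![\sum_i(\alpha_i\cdot e_i)]\!]=\sum_i\alpha_i[\![e_i]\!]$. *)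

theory Defs
  imports "HOL-Analysis.Analysis" "HOL-Library.Multiset"
begin

section \<open>Syntax\<close>

type_synonym var = nat

datatype qtype =
    QOne                  
  | QPlus qtype qtype
  | QTens qtype qtype
  | QNat

datatype bval =
    BStar | BVar var | BInl bval | BInr bval | BTens bval bval | BZero | BSuc bval

text \<open>A linear combination is a finite family of scaled expressions. Families that differ only
  by a renaming of their (finite) index set are identified, so the family is stored as a multiset
  of pairs. The indexed form used in all rules below is \<open>lin\<close>; every finite multiset is of the
  form \<open>lin I \<alpha> t\<close> with \<open>I\<close> a finite set of natural numbers.\<close>

datatype expr =
    EStar | EVar var | EInl expr | EInr expr | ETens expr expr | EZero | ESuc expr
  | ELin "(complex \<times> expr) multiset"

definition lin :: "'i set \<Rightarrow> ('i \<Rightarrow> complex) \<Rightarrow> ('i \<Rightarrow> expr) \<Rightarrow> expr" where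
  "lin I \<alpha> t = ELin (image_mset (\<lambda>i. (\<alpha> i, t i)) (mset_set I))"

primrec expr_of :: "bval \<Rightarrow> expr" where
  "expr_of BStar = EStar"
| "expr_of (BVar x) = EVar x"
| "expr_of (BInl b) = EInl (expr_of b)"
| "expr_of (BInr b) = EInr (expr_of b)"
| "expr_of (BTens b b') = ETens (expr_of b) (expr_of b')"
| "expr_of BZero = EZero"
| "expr_of (BSuc b) = ESuc (expr_of b)"

primrec fv :: "expr \<Rightarrow> var set" where
  "fv EStar = {}"
| "fv (EVar x) = {x}"
| "fv (EInl e) = fv e"
| "fv (EInr e) = fv e"
| "fv (ETens e e') = fv e \<union> fv e'"
| "fv EZero = {}"
| "fv (ESuc e) = fv e"
| "fv (ELin M) = (\<Union>p\<in>set_mset (image_mset (map_prod id fv) M). snd p)"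


section \<open>Orthogonality\<close>

inductive orth :: "expr \<Rightarrow> expr \<Rightarrow> bool" (infix "\<perp>" 50) where
  orth_sym: "t \<perp> t' \<Longrightarrow> t' \<perp> t"
| orth_inl_inr: "EInl t1 \<perp> EInr t2"
| orth_zero_suc: "EZero \<perp> ESuc t"
| orth_suc: "t1 \<perp> t2 \<Longrightarrow> ESuc t1 \<perp> ESuc t2"
| orth_inl: "t1 \<perp> t2 \<Longrightarrow> EInl t1 \<perp> EInl t2"
| orth_inr: "t1 \<perp> t2 \<Longrightarrow> EInr t1 \<perp> EInr t2"
| orth_tens_right: "t1 \<perp> t2 \<Longrightarrow> ETens t t1 \<perp> ETens t' t2"
| orth_tens_left: "t1 \<perp> t2 \<Longrightarrow> ETens t1 t \<perp> ETens t2 t'"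
| orth_lin:
    "finite (I :: nat set) \<Longrightarrow> (\<forall>i\<in>I. t \<perp> s i) \<Longrightarrow> t \<perp> lin I \<alpha> s"
| orth_lin_null:
    "finite (I :: nat set) \<Longrightarrow> k \<notin> I \<Longrightarrow> (\<forall>i\<in>I. t \<perp> s i) \<Longrightarrow> \<alpha> k = 0 \<Longrightarrow> s k = t
      \<Longrightarrow> t \<perp> lin (I \<union> {k}) \<alpha> s"
| orth_lin_lin:
    "finite (I :: nat set) \<Longrightarrow> (\<forall>i\<in>I. \<forall>j\<in>I. i \<noteq> j \<longrightarrow> t i \<perp> t j) \<Longrightarrow> J \<subseteq> I \<Longrightarrow> K \<subseteq> I
      \<Longrightarrow> (\<Sum>i\<in>J \<inter> K. cnj (\<alpha> i) * \<beta> i) = 0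
      \<Longrightarrow> lin J \<alpha> t \<perp> lin K \<beta> t"


section \<open>Orthonormal bases\<close>

definition bproj1 :: "bval set \<Rightarrow> bval set" where
  "bproj1 S = {b. \<exists>b'. BTens b b' \<in> S}"
definition bproj2 :: "bval set \<Rightarrow> bval set" where
  "bproj2 S = {b'. \<exists>b. BTens b b' \<in> S}"
definition bsec1 :: "bval set \<Rightarrow> bval \<Rightarrow> bval set" where
  "bsec1 S b = {b'. BTens b b' \<in> S}"
definition bsec2 :: "bval set \<Rightarrow> bval \<Rightarrow> bval set" where
  "bsec2 S b = {b'. BTens b' b \<in> S}"

inductive ONB :: "qtype \<Rightarrow> bval set \<Rightarrow> bool" where
  "ONB Q {BVar x}"
| "ONB QOne {BStar}"
| "ONB Q1 S \<Longrightarrow> ONB Q2 T \<Longrightarrow> ONB (QPlus Q1 Q2) (BInl ` S \<union> BInr ` T)"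
| "ONB QNat S \<Longrightarrow> ONB QNat ({BZero} \<union> BSuc ` S)"
| "finite S \<Longrightarrow> S \<subseteq> {BTens b b' | b b'. True} \<Longrightarrow>
    ONB Q2 (bproj2 S) \<Longrightarrow> (\<forall>b\<in>bproj2 S. ONB Q1 (bsec2 S b)) \<Longrightarrow> ONB (QTens Q1 Q2) S"
| "finite S \<Longrightarrow> S \<subseteq> {BTens b b' | b b'. True} \<Longrightarrow>
    ONB Q1 (bproj1 S) \<Longrightarrow> (\<forall>b\<in>bproj1 S. ONB Q2 (bsec1 S b)) \<Longrightarrow> ONB (QTens Q1 Q2) S"

definition eproj1 :: "expr set \<Rightarrow> expr set" where
  "eproj1 S = {e. \<exists>e'. ETens e e' \<in> S}"
definition eproj2 :: "expr set \<Rightarrow> expr set" where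
  "eproj2 S = {e'. \<exists>e. ETens e e' \<in> S}"
definition esec1 :: "expr set \<Rightarrow> expr \<Rightarrow> expr set" where
  "esec1 S e = {e'. ETens e e' \<in> S}"
definition esec2 :: "expr set \<Rightarrow> expr \<Rightarrow> expr set" where
  "esec2 S e = {e'. ETens e' e \<in> S}"

definition unitary_matrix_on :: "'i set \<Rightarrow> ('i \<Rightarrow> 'i \<Rightarrow> complex) \<Rightarrow> bool" where
  "unitary_matrix_on S \<alpha> \<longleftrightarrow>
     (\<forall>i\<in>S. \<forall>j\<in>S. (\<Sum>k\<in>S. \<alpha> i k * cnj (\<alpha> j k)) = (if i = j then 1 else 0)) \<and>
     (\<forall>i\<in>S. \<forall>j\<in>S. (\<Sum>k\<in>S. cnj (\<alpha> k i) * \<alpha> k j) = (if i = j then 1 else 0))"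

inductive ONBe :: "qtype \<Rightarrow> expr set \<Rightarrow> bool" where
  "ONBe Q {EVar x}"
| "ONBe QOne {EStar}"
| "ONBe Q1 S \<Longrightarrow> ONBe Q2 T \<Longrightarrow> ONBe (QPlus Q1 Q2) (EInl ` S \<union> EInr ` T)"
| "ONBe QNat S \<Longrightarrow> ONBe QNat ({EZero} \<union> ESuc ` S)"
| "finite S \<Longrightarrow> S \<subseteq> {ETens e e' | e e'. True} \<Longrightarrow>
    ONBe Q2 (eproj2 S) \<Longrightarrow> (\<forall>e\<in>eproj2 S. ONBe Q1 (esec2 S e)) \<Longrightarrow> ONBe (QTens Q1 Q2) S"
| "finite S \<Longrightarrow> S \<subseteq> {ETens e e' | e e'. True} \<Longrightarrow>
    ONBe Q1 (eproj1 S) \<Longrightarrow> (\<forall>e\<in>eproj1 S. ONBe Q2 (esec1 S e)) \<Longrightarrow> ONBe (QTens Q1 Q2) S"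
| "ONBe Q S \<Longrightarrow> finite S \<Longrightarrow> unitary_matrix_on S \<alpha> \<Longrightarrow>
    ONBe Q ((\<lambda>e. lin S (\<lambda>e'. \<alpha> e e') (\<lambda>e'. e')) ` S)"


section \<open>Typing\<close>

type_synonym ctx = "var \<rightharpoonup> qtype"

inductive typed :: "ctx \<Rightarrow> expr \<Rightarrow> qtype \<Rightarrow> bool" where
  typed_star: "typed Map.empty EStar QOne"
| typed_var: "typed [x \<mapsto> Q] (EVar x) Q"
| typed_tens: "typed \<Gamma>1 e1 Q1 \<Longrightarrow> typed \<Gamma>2 e2 Q2 \<Longrightarrow> dom \<Gamma>1 \<inter> dom \<Gamma>2 = {}
    \<Longrightarrow> typed (\<Gamma>1 ++ \<Gamma>2) (ETens e1 e2) (QTens Q1 Q2)"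
| typed_inl: "typed \<Gamma> e Q1 \<Longrightarrow> typed \<Gamma> (EInl e) (QPlus Q1 Q2)"
| typed_inr: "typed \<Gamma> e Q2 \<Longrightarrow> typed \<Gamma> (EInr e) (QPlus Q1 Q2)"
| typed_zero: "typed Map.empty EZero QNat"
| typed_suc: "typed \<Gamma> e QNat \<Longrightarrow> typed \<Gamma> (ESuc e) QNat"
| typed_lin: "finite (I :: nat set) \<Longrightarrow> (\<forall>i\<in>I. typed \<Gamma> (e i) Q)
    \<Longrightarrow> (\<Sum>i\<in>I. (cmod (\<alpha> i))\<^sup>2) = 1
    \<Longrightarrow> (\<forall>i\<in>I. \<forall>j\<in>I. i \<noteq> j \<longrightarrow> e i \<perp> e j)
    \<Longrightarrow> typed \<Gamma> (lin I \<alpha> e) Q"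

text \<open>Derivability of the judgement for the clauses \<open>b i \<mapsto> e i\<close>, \<open>i < n\<close>, where \<open>\<Gamma>\<close> is the family
  of contexts used in the derivation.\<close>

definition iso_typed ::
  "(nat \<Rightarrow> ctx) \<Rightarrow> nat \<Rightarrow> (nat \<Rightarrow> bval) \<Rightarrow> (nat \<Rightarrow> expr) \<Rightarrow> qtype \<Rightarrow> qtype \<Rightarrow> bool" where
  "iso_typed \<Gamma> n b e Q1 Q2 \<longleftrightarrow>
     (\<forall>i<n. typed (\<Gamma> i) (expr_of (b i)) Q1) \<and>
     (\<forall>i<n. typed (\<Gamma> i) (e i) Q2) \<and>
     inj_on b {..<n} \<and> inj_on e {..<n} \<and>
     ONB Q1 (b ` {..<n}) \<and> ONBe Q2 (e ` {..<n})"


section \<open>Hilbert spaces and operators\<close>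

text \<open>All Hilbert spaces are of the form \<open>\<ell>\<^sup>2(X)\<close> for a set \<open>X\<close>, represented by the square-summable
  functions that vanish outside \<open>X\<close>. Direct sums and tensor products are
  \<open>\<ell>\<^sup>2(X) \<oplus> \<ell>\<^sup>2(Y) = \<ell>\<^sup>2(X + Y)\<close> and \<open>\<ell>\<^sup>2(X) \<otimes> \<ell>\<^sup>2(Y) = \<ell>\<^sup>2(X \<times> Y)\<close>.\<close>

definition ell2 :: "'a set \<Rightarrow> ('a \<Rightarrow> complex) set" where
  "ell2 X = {f. (\<forall>x. x \<notin> X \<longrightarrow> f x = 0) \<and> (\<lambda>x. (cmod (f x))\<^sup>2) summable_on X}"

definition ip :: "'a set \<Rightarrow> ('a \<Rightarrow> complex) \<Rightarrow> ('a \<Rightarrow> complex) \<Rightarrow> complex" where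
  "ip X f g = (\<Sum>\<^sub>\<infinity>x\<in>X. cnj (f x) * g x)"

definition ell2_norm :: "'a set \<Rightarrow> ('a \<Rightarrow> complex) \<Rightarrow> real" where
  "ell2_norm X f = sqrt (\<Sum>\<^sub>\<infinity>x\<in>X. (cmod (f x))\<^sup>2)"

definition bounded_op ::
  "'a set \<Rightarrow> 'b set \<Rightarrow> (('a \<Rightarrow> complex) \<Rightarrow> ('b \<Rightarrow> complex)) \<Rightarrow> bool" where
  "bounded_op X Y A \<longleftrightarrow>
     (\<forall>f\<in>ell2 X. A f \<in> ell2 Y) \<and>
     (\<forall>f\<in>ell2 X. \<forall>g\<in>ell2 X. A (\<lambda>x. f x + g x) = (\<lambda>y. A f y + A g y)) \<and>
     (\<forall>f\<in>ell2 X. \<forall>c. A (\<lambda>x. c * f x) = (\<lambda>y. c * A f y)) \<and>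
     (\<exists>C. \<forall>f\<in>ell2 X. ell2_norm Y (A f) \<le> C * ell2_norm X f)"

definition adj ::
  "'a set \<Rightarrow> 'b set \<Rightarrow> (('a \<Rightarrow> complex) \<Rightarrow> ('b \<Rightarrow> complex)) \<Rightarrow> (('b \<Rightarrow> complex) \<Rightarrow> ('a \<Rightarrow> complex))" where
  "adj X Y A g = (THE f. f \<in> ell2 X \<and> (\<forall>h\<in>ell2 X. ip Y (A h) g = ip X h f))"

definition unitary_op ::
  "'a set \<Rightarrow> 'b set \<Rightarrow> (('a \<Rightarrow> complex) \<Rightarrow> ('b \<Rightarrow> complex)) \<Rightarrow> bool" where
  "unitary_op X Y U \<longleftrightarrow>
     bounded_op X Y U \<and>
     (\<forall>f\<in>ell2 X. adj X Y U (U f) = f) \<and>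
     (\<forall>g\<in>ell2 Y. U (adj X Y U g) = g)"

text \<open>The tensor product of two bounded operators, as the composite of \<open>id \<otimes> B\<close> and \<open>A \<otimes> id\<close>,
  each of which acts fibrewise.\<close>

definition tensor_op ::
  "(('a \<Rightarrow> complex) \<Rightarrow> ('c \<Rightarrow> complex)) \<Rightarrow> (('b \<Rightarrow> complex) \<Rightarrow> ('d \<Rightarrow> complex))
   \<Rightarrow> ('a \<times> 'b \<Rightarrow> complex) \<Rightarrow> ('c \<times> 'd \<Rightarrow> complex)" where
  "tensor_op A B f = (\<lambda>(p, q). A (\<lambda>x. B (\<lambda>y. f (x, y)) q) p)"

lemma tensor_op_elementary:
  assumes "bounded_op X Y A" "bounded_op X' Y' B" "u \<in> ell2 X" "v \<in> ell2 X'"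
  shows "tensor_op A B (\<lambda>(x, y). u x * v y) = (\<lambda>(p, q). A u p * B v q)"
proof -
  have B: "B (\<lambda>y. c * v y) q = c * B v q" for c q
    using assms(2,4) by (simp add: bounded_op_def)
  have A: "A (\<lambda>x. c * u x) p = c * A u p" for c p
    using assms(1,3) by (simp add: bounded_op_def)
  have "A (\<lambda>x. u x * B v q) p = A u p * B v q" for p q
    using A[of "B v q" p] by (simp add: mult.commute)
  thus ?thesis by (simp add: tensor_op_def B)
qed


section \<open>Denotations\<close>

text \<open>Labels of the canonical orthonormal basis of the interpretation of a type.\<close>

datatype lab = LUnit | LInl lab | LInr lab | LPair lab lab | LNat nat

primrec qbasis :: "qtype \<Rightarrow> lab set" where
  "qbasis QOne = {LUnit}"
| "qbasis (QPlus Q1 Q2) = LInl ` qbasis Q1 \<union> LInr ` qbasis Q2"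
| "qbasis (QTens Q1 Q2) = {LPair p q | p q. p \<in> qbasis Q1 \<and> q \<in> qbasis Q2}"
| "qbasis QNat = range LNat"

text \<open>A context denotes the (unordered) tensor product of its types: the space over all
  assignments of basis labels to its variables. For the empty context this is \<open>\<complex>\<close>.\<close>

definition cbasis :: "ctx \<Rightarrow> (var \<rightharpoonup> lab) set" where
  "cbasis \<Gamma> = {\<sigma>. dom \<sigma> = dom \<Gamma> \<and> (\<forall>x Q l. \<Gamma> x = Some Q \<longrightarrow> \<sigma> x = Some l \<longrightarrow> l \<in> qbasis Q)}"

abbreviation qspace :: "qtype \<Rightarrow> (lab \<Rightarrow> complex) set" where
  "qspace Q \<equiv> ell2 (qbasis Q)"

abbreviation cspace :: "ctx \<Rightarrow> ((var \<rightharpoonup> lab) \<Rightarrow> complex) set" where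
  "cspace \<Gamma> \<equiv> ell2 (cbasis \<Gamma>)"

text \<open>The canonical isomorphism from the space of a disjoint union of contexts to the tensor
  product of their spaces.\<close>

definition ctx_split ::
  "ctx \<Rightarrow> ctx \<Rightarrow> ((var \<rightharpoonup> lab) \<Rightarrow> complex) \<Rightarrow> ((var \<rightharpoonup> lab) \<times> (var \<rightharpoonup> lab) \<Rightarrow> complex)" where
  "ctx_split \<Gamma>1 \<Gamma>2 f =
     (\<lambda>(\<sigma>, \<tau>). if \<sigma> \<in> cbasis \<Gamma>1 \<and> \<tau> \<in> cbasis \<Gamma>2 then f (\<sigma> ++ \<tau>) else 0)"

definition pair_lab :: "(lab \<times> lab \<Rightarrow> complex) \<Rightarrow> (lab \<Rightarrow> complex)" where
  "pair_lab g = (\<lambda>l. case l of LPair p q \<Rightarrow> g (p, q) | _ \<Rightarrow> 0)"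

definition inl_op :: "(lab \<Rightarrow> complex) \<Rightarrow> (lab \<Rightarrow> complex)" where
  "inl_op g = (\<lambda>l. case l of LInl p \<Rightarrow> g p | _ \<Rightarrow> 0)"

definition inr_op :: "(lab \<Rightarrow> complex) \<Rightarrow> (lab \<Rightarrow> complex)" where
  "inr_op g = (\<lambda>l. case l of LInr p \<Rightarrow> g p | _ \<Rightarrow> 0)"

definition succ_op :: "(lab \<Rightarrow> complex) \<Rightarrow> (lab \<Rightarrow> complex)" where
  "succ_op g = (\<lambda>l. case l of LNat (Suc n) \<Rightarrow> g (LNat n) | _ \<Rightarrow> 0)"

text \<open>\<open>den e \<Gamma>\<close> is the operator from \<open>cspace \<Gamma>\<close> to \<open>qspace Q\<close> denoted by a derivation of
  \<open>typed \<Gamma> e Q\<close>; it is meaningless on ill-typed arguments. As contexts are used linearly, the splitting of the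
  context at a tensor is determined by the free variables (\<open>den_tens\<close> below).\<close>

primrec den :: "expr \<Rightarrow> ctx \<Rightarrow> ((var \<rightharpoonup> lab) \<Rightarrow> complex) \<Rightarrow> (lab \<Rightarrow> complex)" where
  "den EStar = (\<lambda>\<Gamma> f l. if l = LUnit then f Map.empty else 0)"
| "den (EVar x) = (\<lambda>\<Gamma> f l. f [x \<mapsto> l])"
| "den (EInl e) = (\<lambda>\<Gamma> f. inl_op (den e \<Gamma> f))"
| "den (EInr e) = (\<lambda>\<Gamma> f. inr_op (den e \<Gamma> f))"
| "den (ETens e e') = (\<lambda>\<Gamma> f. pair_lab
     (tensor_op (den e (\<Gamma> |` fv e)) (den e' (\<Gamma> |` fv e'))
       (ctx_split (\<Gamma> |` fv e) (\<Gamma> |` fv e') f)))"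
| "den EZero = (\<lambda>\<Gamma> f l. if l = LNat 0 then f Map.empty else 0)"
| "den (ESuc e) = (\<lambda>\<Gamma> f. succ_op (den e \<Gamma> f))"
| "den (ELin M) = (\<lambda>\<Gamma> f l. \<Sum>p\<in>#image_mset (map_prod id den) M. fst p * snd p \<Gamma> f l)"

lemma den_lin: "den (lin I \<alpha> t) \<Gamma> f = (\<lambda>l. \<Sum>i\<in>I. \<alpha> i * den (t i) \<Gamma> f l)"
  by (simp add: lin_def sum_unfold_sum_mset image_mset.compositionality comp_def)

lemma fv_lin: "finite I \<Longrightarrow> fv (lin I \<alpha> t) = (\<Union>i\<in>I. fv (t i))"
  by (auto simp: lin_def)

lemma typed_fv: "typed \<Gamma> e Q \<Longrightarrow> fv e = dom \<Gamma>"
proof (induction rule: typed.induct)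
  case (typed_lin I \<Gamma> e Q \<alpha>)
  moreover have "I \<noteq> {}" using typed_lin by auto
  ultimately show ?case by (auto simp: fv_lin simp del: fv.simps)
qed (auto split: if_splits)

lemma den_tens:
  assumes "typed \<Gamma>1 e1 Q1" "typed \<Gamma>2 e2 Q2" "dom \<Gamma>1 \<inter> dom \<Gamma>2 = {}"
  shows "den (ETens e1 e2) (\<Gamma>1 ++ \<Gamma>2) f =
    pair_lab (tensor_op (den e1 \<Gamma>1) (den e2 \<Gamma>2) (ctx_split \<Gamma>1 \<Gamma>2 f))"
proof -
  have "(\<Gamma>1 ++ \<Gamma>2) |` dom \<Gamma>1 = \<Gamma>1" "(\<Gamma>1 ++ \<Gamma>2) |` dom \<Gamma>2 = \<Gamma>2"
    using assms(3) by (auto simp: fun_eq_iff restrict_map_def map_add_def split: option.splits)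
  thus ?thesis by (simp add: typed_fv[OF assms(1)] typed_fv[OF assms(2)])
qed

definition iso_den ::
  "(nat \<Rightarrow> ctx) \<Rightarrow> nat \<Rightarrow> (nat \<Rightarrow> bval) \<Rightarrow> (nat \<Rightarrow> expr) \<Rightarrow> qtype
   \<Rightarrow> (lab \<Rightarrow> complex) \<Rightarrow> (lab \<Rightarrow> complex)" where
  "iso_den \<Gamma> n b e Q1 g = (\<lambda>l. \<Sum>i<n.
     den (e i) (\<Gamma> i) (adj (cbasis (\<Gamma> i)) (qbasis Q1) (den (expr_of (b i)) (\<Gamma> i)) g) l)"

end

(*
  In the canonical bases every expression denotes a matrix with finitely many nonzero entries in each
  row and each column, so that compositions of these operators and their adjoints reduce to finite
  sums. By induction on the derivation of ONBe_Q(S), the matrices A_e of the expressions e in S satisfy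
  A_e^* A_f = delta_(e,f) and sum_e A_e A_e^* = 1; in the rule for linear combinations this is just the
  unitarity of the coefficient matrix, all members of S being typed in the same context. Hence, if the
  B_i belong to the left-hand sides, U = sum_i A_i B_i^* has the inverse and adjoint sum_i B_i A_i^*.
*)

theory Submission
  imports Defs "HOL-Library.Groups_Big_Fun"
begin

section \<open>Square-summable functions\<close>

text \<open>Since qnat is infinite-dimensional, completeness cannot be deduced from orthonormality
  by counting dimensions; it needs an induction of its own. The two inductions use the two halves of
  the unitarity of the coefficient matrix: orthonormal rows for the first, orthonormal columns for
  the second. Members of a basis may live in different contexts, so the delta in the orthonormality
  relation compares an expression together with an assignment of its context; for tensors this is
  consistent because an expression and its type determine the context. Only the matrix algebra is
  finite: membership in \<open>ell2\<close> and the adjoint equation are statements about arbitrary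
  vectors. They are obtained from finitely supported vectors, where all identities are exact finite
  sums, by bounds uniform in the support and, for the adjoint, a limit. Left-hand sides need no
  separate treatment, as basis values embed into expressions.\<close>

lemma of_real_cmod_power2: "complex_of_real ((cmod z)\<^sup>2) = cnj z * z"
  by (simp add: complex_norm_square mult.commute flip: of_real_power)

definition sqsum :: "'a set \<Rightarrow> ('a \<Rightarrow> complex) \<Rightarrow> real" where
  "sqsum X f = (\<Sum>\<^sub>\<infinity>x\<in>X. (cmod (f x))\<^sup>2)"

lemma ell2D:
  assumes "f \<in> ell2 X"
  shows "x \<notin> X \<Longrightarrow> f x = 0" "(\<lambda>x. (cmod (f x))\<^sup>2) summable_on X"
  using assms by (auto simp: ell2_def)

lemma ell2_I:
  assumes "\<And>x. x \<notin> X \<Longrightarrow> f x = 0"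
    and "\<And>F. finite F \<Longrightarrow> F \<subseteq> X \<Longrightarrow> (\<Sum>x\<in>F. (cmod (f x))\<^sup>2) \<le> B"
  shows "f \<in> ell2 X" "sqsum X f \<le> B"
proof -
  have s: "(\<lambda>x. (cmod (f x))\<^sup>2) summable_on X"
    by (rule nonneg_bdd_above_summable_on) (use assms(2) in \<open>auto intro!: bdd_aboveI[of _ B]\<close>)
  thus "f \<in> ell2 X" using assms(1) by (simp add: ell2_def)
  show "sqsum X f \<le> B" unfolding sqsum_def
    by (rule infsum_le_finite_sums[OF s]) (use assms(2) in auto)
qed

lemma sum_le_sqsum:
  assumes "f \<in> ell2 X" "finite F" "F \<subseteq> X"
  shows "(\<Sum>x\<in>F. (cmod (f x))\<^sup>2) \<le> sqsum X f"
  unfolding sqsum_def using assms by (intro finite_sum_le_infsum) (auto simp: ell2_def)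

lemma sqsum_nonneg: "0 \<le> sqsum X f"
  unfolding sqsum_def by (rule infsum_nonneg) auto

lemma ell2_cmult: "f \<in> ell2 X \<Longrightarrow> (\<lambda>x. c * f x) \<in> ell2 X"
  by (auto simp: ell2_def norm_mult power_mult_distrib intro: summable_on_cmult_right)

lemma ell2_add:
  assumes "f \<in> ell2 X" "g \<in> ell2 X"
  shows "(\<lambda>x. f x + g x) \<in> ell2 X"
proof (rule ell2_I(1))
  show "f x + g x = 0" if "x \<notin> X" for x using that assms by (simp add: ell2D)
next
  fix F assume F: "finite F" "F \<subseteq> X"
  have "(cmod (a + b))\<^sup>2 \<le> 2 * (cmod a)\<^sup>2 + 2 * (cmod b)\<^sup>2" for a b :: complex
  proof -
    have "(cmod (a + b))\<^sup>2 \<le> (cmod a + cmod b)\<^sup>2" by (simp add: norm_triangle_ineq power_mono)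
    also have "\<dots> \<le> 2 * (cmod a)\<^sup>2 + 2 * (cmod b)\<^sup>2"
      using zero_le_power2[of "cmod a - cmod b"] by (simp add: power2_sum power2_diff)
    finally show ?thesis .
  qed
  hence "(\<Sum>x\<in>F. (cmod (f x + g x))\<^sup>2) \<le> (\<Sum>x\<in>F. 2 * (cmod (f x))\<^sup>2 + 2 * (cmod (g x))\<^sup>2)"
    by (intro sum_mono)
  also have "\<dots> = 2 * (\<Sum>x\<in>F. (cmod (f x))\<^sup>2) + 2 * (\<Sum>x\<in>F. (cmod (g x))\<^sup>2)"
    by (simp add: sum.distrib sum_distrib_left)
  also have "\<dots> \<le> 2 * sqsum X f + 2 * sqsum X g"
    using sum_le_sqsum[OF assms(1) F] sum_le_sqsum[OF assms(2) F] by simp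
  finally show "(\<Sum>x\<in>F. (cmod (f x + g x))\<^sup>2) \<le> 2 * sqsum X f + 2 * sqsum X g" .
qed

lemma ell2_sum: "(\<And>i. i \<in> I \<Longrightarrow> f i \<in> ell2 X) \<Longrightarrow> (\<lambda>x. \<Sum>i\<in>I. f i x) \<in> ell2 X"
proof (induction I rule: infinite_finite_induct)
  case (insert i I)
  thus ?case using ell2_add[of "f i" X "\<lambda>x. \<Sum>i\<in>I. f i x"] by simp
qed (auto simp: ell2_def)

lemma ell2_finite_support:
  assumes "finite F" "F \<subseteq> X"
  shows "(\<lambda>x. if x \<in> F then f x else 0) \<in> ell2 X"
proof -
  have "(\<lambda>x. (cmod (if x \<in> F then f x else 0))\<^sup>2) summable_on X \<longleftrightarrow>
    (\<lambda>x. (cmod (f x))\<^sup>2) summable_on F"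
    by (rule summable_on_cong_neutral) (use assms in auto)
  thus ?thesis using assms by (auto simp: ell2_def)
qed

text \<open>The bound does not depend on the finite set, so it yields both absolute summability of
  the inner product and, in the limit, the Cauchy-Schwarz inequality.\<close>

lemma ip_bound_finite:
  assumes "f \<in> ell2 X" "g \<in> ell2 X" "finite F" "F \<subseteq> X"
  shows "(\<Sum>x\<in>F. cmod (cnj (f x) * g x)) \<le> sqrt (sqsum X f) * sqrt (sqsum X g)"
proof -
  have "(\<Sum>x\<in>F. cmod (cnj (f x) * g x)) \<le> (\<Sum>x\<in>F. \<bar>cmod (f x)\<bar> * \<bar>cmod (g x)\<bar>)"
    by (simp add: norm_mult)
  also have "\<dots> \<le> L2_set (\<lambda>x. cmod (f x)) F * L2_set (\<lambda>x. cmod (g x)) F"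
    by (rule L2_set_mult_ineq)
  also have "\<dots> \<le> sqrt (sqsum X f) * sqrt (sqsum X g)"
    unfolding L2_set_def
    by (intro mult_mono real_sqrt_le_mono sum_le_sqsum assms) (auto intro: sum_nonneg sqsum_nonneg)
  finally show ?thesis .
qed

lemma ip_abs_summable:
  assumes "f \<in> ell2 X" "g \<in> ell2 X"
  shows "(\<lambda>x. cmod (cnj (f x) * g x)) summable_on X"
  by (rule nonneg_bdd_above_summable_on)
    (use ip_bound_finite[OF assms] in \<open>auto intro!: bdd_aboveI[of _ "sqrt (sqsum X f) * sqrt (sqsum X g)"]\<close>)

lemma ip_summable: "f \<in> ell2 X \<Longrightarrow> g \<in> ell2 X \<Longrightarrow> (\<lambda>x. cnj (f x) * g x) summable_on X"
  by (rule abs_summable_summable[OF ip_abs_summable])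

lemma Cauchy_Schwarz_ip:
  assumes "f \<in> ell2 X" "g \<in> ell2 X"
  shows "cmod (ip X f g) \<le> sqrt (sqsum X f) * sqrt (sqsum X g)"
proof -
  have "cmod (ip X f g) \<le> (\<Sum>\<^sub>\<infinity>x\<in>X. cmod (cnj (f x) * g x))"
    using norm_infsum_bound[OF ip_abs_summable[OF assms]] by (simp add: ip_def)
  also have "\<dots> \<le> sqrt (sqsum X f) * sqrt (sqsum X g)"
    by (rule infsum_le_finite_sums[OF ip_abs_summable[OF assms]]) (use ip_bound_finite[OF assms] in auto)
  finally show ?thesis .
qed

lemma ip_add_left:
  assumes "f \<in> ell2 X" "f' \<in> ell2 X" "g \<in> ell2 X"
  shows "ip X (\<lambda>x. f x + f' x) g = ip X f g + ip X f' g"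
  using infsum_add[OF ip_summable[OF assms(1,3)] ip_summable[OF assms(2,3)]]
  by (simp add: ip_def ring_distribs)

lemma ip_cnj: "cnj (ip X f g) = ip X g f"
  unfolding ip_def infsum_cnj[symmetric] by (simp add: mult.commute)

lemma ip_sum_left:
  assumes "\<And>i. i \<in> I \<Longrightarrow> f i \<in> ell2 X" "g \<in> ell2 X"
  shows "ip X (\<lambda>x. \<Sum>i\<in>I. f i x) g = (\<Sum>i\<in>I. ip X (f i) g)"
  using assms(1)
proof (induction I rule: infinite_finite_induct)
  case (insert i I)
  thus ?case using ip_add_left[of "f i" X "\<lambda>x. \<Sum>i\<in>I. f i x" g] by (simp add: ell2_sum assms)
qed (auto simp: ip_def)

lemma ip_sum_right:
  assumes "\<And>i. i \<in> I \<Longrightarrow> g i \<in> ell2 X" "f \<in> ell2 X"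
  shows "ip X f (\<lambda>x. \<Sum>i\<in>I. g i x) = (\<Sum>i\<in>I. ip X f (g i))"
  using arg_cong[OF ip_sum_left[of I g X f, OF assms], of cnj] by (simp add: ip_cnj)

lemma ip_self:
  assumes "f \<in> ell2 X"
  shows "ip X f f = complex_of_real (sqsum X f)"
proof -
  have "(\<lambda>x. cnj (f x) * f x) = (\<lambda>x. complex_of_real ((cmod (f x))\<^sup>2))"
    by (simp add: of_real_cmod_power2 del: of_real_power)
  thus ?thesis unfolding ip_def sqsum_def
    by (simp only: infsumI[OF has_sum_of_real[OF has_sum_infsum[OF ell2D(2)[OF assms]]]])
qed

lemma ip_finite_support_left:
  assumes "finite F" "F \<subseteq> X" "\<And>x. x \<in> X - F \<Longrightarrow> f x = 0"
  shows "ip X f g = (\<Sum>x\<in>F. cnj (f x) * g x)"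
proof -
  have "ip X f g = (\<Sum>\<^sub>\<infinity>x\<in>F. cnj (f x) * g x)"
    unfolding ip_def by (rule infsum_cong_neutral) (use assms in auto)
  thus ?thesis using assms by simp
qed

text \<open>Testing against unit vectors recovers every coordinate; this is the uniqueness behind
  the definite description in \<open>adj\<close>.\<close>

lemma ell2_ext_ip:
  assumes "f \<in> ell2 X" "g \<in> ell2 X" "\<And>h. h \<in> ell2 X \<Longrightarrow> ip X h f = ip X h g"
  shows "f = g"
proof
  fix x
  show "f x = g x"
  proof (cases "x \<in> X")
    case True
    let ?d = "\<lambda>y. if y \<in> {x} then 1 else 0 :: complex"
    have "ip X ?d h = h x" for h
      using True by (subst ip_finite_support_left[of "{x}"]) auto
    thus ?thesis using assms(3)[of ?d] True ell2_finite_support[of "{x}" X "\<lambda>_. 1"] by simp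
  qed (use assms in \<open>simp add: ell2D\<close>)
qed

section \<open>Adjoints and unitarity\<close>

lemma adj_eqI:
  assumes "f \<in> ell2 X" "\<And>h. h \<in> ell2 X \<Longrightarrow> ip Y (A h) g = ip X h f"
  shows "adj X Y A g = f"
  unfolding adj_def
proof (rule the_equality)
  fix f' assume "f' \<in> ell2 X \<and> (\<forall>h\<in>ell2 X. ip Y (A h) g = ip X h f')"
  thus "f' = f" using assms by (intro ell2_ext_ip[of f' X f]) auto
qed (use assms in auto)

text \<open>A two-sided inverse \<open>V\<close> satisfying the adjoint equation is the adjoint by
  uniqueness. Boundedness with constant 1 follows: the inner product of \<open>U f\<close> with
  itself equals that of \<open>f\<close> with \<open>V (U f)\<close>, which is
  \<open>f\<close>.\<close>

lemma unitary_opI: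
  assumes U: "\<And>f. f \<in> ell2 X \<Longrightarrow> U f \<in> ell2 Y"
    and add: "\<And>f g. f \<in> ell2 X \<Longrightarrow> g \<in> ell2 X \<Longrightarrow> U (\<lambda>x. f x + g x) = (\<lambda>y. U f y + U g y)"
    and scale: "\<And>f c. f \<in> ell2 X \<Longrightarrow> U (\<lambda>x. c * f x) = (\<lambda>y. c * U f y)"
    and V: "\<And>g. g \<in> ell2 Y \<Longrightarrow> V g \<in> ell2 X"
    and adjoint: "\<And>f g. f \<in> ell2 X \<Longrightarrow> g \<in> ell2 Y \<Longrightarrow> ip Y (U f) g = ip X f (V g)"
    and VU: "\<And>f. f \<in> ell2 X \<Longrightarrow> V (U f) = f"
    and UV: "\<And>g. g \<in> ell2 Y \<Longrightarrow> U (V g) = g"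
  shows "unitary_op X Y U"
proof -
  have adj: "adj X Y U g = V g" if "g \<in> ell2 Y" for g
    by (rule adj_eqI) (use V adjoint that in auto)
  have "sqsum Y (U f) = sqsum X f" if "f \<in> ell2 X" for f
    using adjoint[OF that U[OF that]] VU[OF that] by (simp add: ip_self U that)
  hence "\<exists>C. \<forall>f\<in>ell2 X. ell2_norm Y (U f) \<le> C * ell2_norm X f"
    by (intro exI[of _ 1]) (simp add: ell2_norm_def sqsum_def)
  thus ?thesis
    using U V by (simp add: unitary_op_def bounded_op_def add scale adj VU UV)
qed

section \<open>Operators of row- and column-finite matrices\<close>

text \<open>\<open>Sum_any\<close> ranges over the support of the summand, so with finite rows the
  value is a genuine finite sum for every function \<open>f\<close>, square-summable or not.
  Algebraic identities can thus be proved before membership in \<open>ell2\<close> is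
  settled.\<close>

definition mat_op :: "('b \<Rightarrow> 'a \<Rightarrow> complex) \<Rightarrow> ('a \<Rightarrow> complex) \<Rightarrow> 'b \<Rightarrow> complex" where
  "mat_op M f y = Sum_any (\<lambda>x. M y x * f x)"

definition ctrans :: "('b \<Rightarrow> 'a \<Rightarrow> complex) \<Rightarrow> 'a \<Rightarrow> 'b \<Rightarrow> complex" where
  "ctrans M x y = cnj (M y x)"

lemma Sum_any_zero: "(\<And>a. g a = 0) \<Longrightarrow> Sum_any g = 0"
  by (subst Sum_any.expand_superset[of "{}"]) auto

lemma mat_op_eq_sum:
  assumes "finite A" "{x. M y x \<noteq> 0} \<subseteq> A"
  shows "mat_op M f y = (\<Sum>x\<in>A. M y x * f x)"
  unfolding mat_op_def using assms by (intro Sum_any.expand_superset) auto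

lemma mat_op_add:
  assumes "\<And>y. finite {x. M y x \<noteq> 0}"
  shows "mat_op M (\<lambda>x. f x + g x) = (\<lambda>y. mat_op M f y + mat_op M g y)"
  by (simp add: fun_eq_iff mat_op_eq_sum[OF assms subset_refl] ring_distribs sum.distrib)

lemma mat_op_scale:
  assumes "\<And>y. finite {x. M y x \<noteq> 0}"
  shows "mat_op M (\<lambda>x. c * f x) = (\<lambda>y. c * mat_op M f y)"
  by (simp add: fun_eq_iff mat_op_eq_sum[OF assms subset_refl] sum_distrib_left mult.left_commute)

lemma mat_op_sum:
  assumes "\<And>y. finite {x. M y x \<noteq> 0}"
  shows "mat_op M (\<lambda>x. \<Sum>i\<in>I. f i x) = (\<lambda>y. \<Sum>i\<in>I. mat_op M (f i) y)"
  unfolding fun_eq_iff mat_op_eq_sum[OF assms subset_refl] sum_distrib_left by (intro allI sum.swap)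

text \<open>The finite row \<open>y\<close> of \<open>M\<close> selects finitely many rows of
  \<open>N\<close>, each finite, so the union \<open>C\<close> of their supports is finite and the
  claim is an exchange of two finite sums.\<close>

lemma mat_op_mat_op:
  assumes "\<And>y. finite {x. M y x \<noteq> 0}" "\<And>x. finite {z. N x z \<noteq> 0}"
  shows "mat_op M (mat_op N f) y = Sum_any (\<lambda>z. Sum_any (\<lambda>x. M y x * N x z) * f z)"
proof -
  define R where "R = {x. M y x \<noteq> 0}"
  define C where "C = (\<Union>x\<in>R. {z. N x z \<noteq> 0})"
  have fin: "finite R" "finite C" using assms by (auto simp: R_def C_def)
  have MN: "Sum_any (\<lambda>x. M y x * N x z) = (\<Sum>x\<in>R. M y x * N x z)" for z
    by (intro Sum_any.expand_superset fin) (auto simp: R_def)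
  have "mat_op M (mat_op N f) y = (\<Sum>x\<in>R. M y x * mat_op N f x)"
    by (intro mat_op_eq_sum fin) (auto simp: R_def)
  also have "\<dots> = (\<Sum>x\<in>R. M y x * (\<Sum>z\<in>C. N x z * f z))"
    by (intro sum.cong refl arg_cong2[of _ _ _ _ "(*)"] mat_op_eq_sum fin) (auto simp: C_def)
  also have "\<dots> = (\<Sum>z\<in>C. (\<Sum>x\<in>R. M y x * N x z) * f z)"
    unfolding sum_distrib_left sum_distrib_right by (subst sum.swap) (simp add: mult.assoc)
  also have "\<dots> = Sum_any (\<lambda>z. (\<Sum>x\<in>R. M y x * N x z) * f z)"
    by (rule Sum_any.expand_superset[symmetric, OF fin(2)])
      (auto simp: C_def R_def elim!: sum.not_neutral_contains_not_neutral)
  finally show ?thesis unfolding MN .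
qed

text \<open>Finite rows let the matrix act, finite columns let its conjugate transpose act.
  \<open>X\<close> and \<open>Y\<close> are only subsets of the index types, so the support
  condition keeps both actions inside the two spaces.\<close>

locale isometric_matrix =
  fixes X :: "'a set" and Y :: "'b set" and M :: "'b \<Rightarrow> 'a \<Rightarrow> complex"
  assumes finite_row: "finite {x. M y x \<noteq> 0}"
    and finite_col: "finite {y. M y x \<noteq> 0}"
    and support: "M y x \<noteq> 0 \<Longrightarrow> x \<in> X \<and> y \<in> Y"
    and orthonormal: "x \<in> X \<Longrightarrow> x' \<in> X \<Longrightarrow>
      Sum_any (\<lambda>y. cnj (M y x) * M y x') = (if x = x' then 1 else 0)"
begin

lemma finite_row_ctrans: "finite {y. ctrans M x y \<noteq> 0}"
  using finite_col by (simp add: ctrans_def)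

lemma mat_op_ctrans_cols: "finite H \<Longrightarrow> {y. M y x \<noteq> 0} \<subseteq> H \<Longrightarrow> mat_op (ctrans M) g x = (\<Sum>y\<in>H. cnj (M y x) * g y)"
  by (subst mat_op_eq_sum[of H]) (auto simp: ctrans_def)

text \<open>Expanding the squared modulus leaves the Gram matrix of the columns, which is the
  identity. \<open>H\<close> may be any finite set containing the supports of the columns in
  \<open>G\<close>, a freedom that lets a given set of rows be enlarged.\<close>

lemma finite_support_isometric:
  assumes "finite G" "G \<subseteq> X" "finite H" "(\<Union>x\<in>G. {y. M y x \<noteq> 0}) \<subseteq> H"
  shows "(\<Sum>y\<in>H. (cmod (\<Sum>x\<in>G. M y x * h x))\<^sup>2) = (\<Sum>x\<in>G. (cmod (h x))\<^sup>2)"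
proof -
  have col: "(\<Sum>y\<in>H. cnj (M y x) * M y x') = (if x = x' then 1 else 0)" if "x \<in> G" "x' \<in> G" for x x'
  proof -
    have "(\<Sum>y\<in>H. cnj (M y x) * M y x') = Sum_any (\<lambda>y. cnj (M y x) * M y x')"
      by (rule Sum_any.expand_superset[symmetric]) (use assms that in auto)
    thus ?thesis using orthonormal[of x x'] that assms(2) by (simp add: subset_iff)
  qed
  have "complex_of_real (\<Sum>y\<in>H. (cmod (\<Sum>x\<in>G. M y x * h x))\<^sup>2) =
    (\<Sum>y\<in>H. \<Sum>x\<in>G. \<Sum>x'\<in>G. cnj (h x) * h x' * (cnj (M y x) * M y x'))"
    unfolding of_real_sum
  proof (rule sum.cong[OF refl])
    fix y
    have "complex_of_real ((cmod (\<Sum>x\<in>G. M y x * h x))\<^sup>2) =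
      (\<Sum>x\<in>G. cnj (M y x * h x)) * (\<Sum>x\<in>G. M y x * h x)"
      unfolding cnj_sum[symmetric] by (simp only: of_real_cmod_power2)
    also have "\<dots> = (\<Sum>x\<in>G. \<Sum>x'\<in>G. cnj (M y x * h x) * (M y x' * h x'))"
      by (rule sum_product)
    also have "\<dots> = (\<Sum>x\<in>G. \<Sum>x'\<in>G. cnj (h x) * h x' * (cnj (M y x) * M y x'))"
      by (intro sum.cong refl) simp
    finally show "complex_of_real ((cmod (\<Sum>x\<in>G. M y x * h x))\<^sup>2) = \<dots>" .
  qed
  also have "\<dots> = (\<Sum>x\<in>G. \<Sum>x'\<in>G. cnj (h x) * h x' * (\<Sum>y\<in>H. cnj (M y x) * M y x'))"
    unfolding sum_distrib_left
    by (subst sum.swap, intro sum.cong refl, subst sum.swap, rule refl)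
  also have "\<dots> = (\<Sum>x\<in>G. \<Sum>x'\<in>G. if x = x' then cnj (h x) * h x' else 0)"
    by (intro sum.cong refl) (simp add: col)
  also have "\<dots> = (\<Sum>x\<in>G. cnj (h x) * h x)" by (simp add: assms(1))
  also have "\<dots> = complex_of_real (\<Sum>x\<in>G. (cmod (h x))\<^sup>2)"
    by (simp add: of_real_cmod_power2 del: of_real_power)
  finally show ?thesis by (simp only: of_real_eq_iff)
qed

lemma
  assumes f: "f \<in> ell2 X"
  shows mat_op_ell2: "mat_op M f \<in> ell2 Y" and sqsum_mat_op: "sqsum Y (mat_op M f) \<le> sqsum X f"
proof -
  have 1: "mat_op M f y = 0" if "y \<notin> Y" for y
  proof -
    have "M y x = 0" for x using support[of y x] that by auto
    thus ?thesis by (simp add: mat_op_def)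
  qed
  have 2: "(\<Sum>y\<in>F. (cmod (mat_op M f y))\<^sup>2) \<le> sqsum X f" if "finite F" "F \<subseteq> Y" for F
  proof -
    \<comment> \<open>The rows in \<open>F\<close> see only the columns in \<open>G\<close>. Adding
      every row met by these columns gives \<open>H\<close>, where the isometry is exact; passing
      from \<open>F\<close> to \<open>H\<close> only increases the sum.\<close>
    define G where "G = (\<Union>y\<in>F. {x. M y x \<noteq> 0})"
    define H where "H = F \<union> (\<Union>x\<in>G. {y. M y x \<noteq> 0})"
    have fin: "finite G" "finite H" "G \<subseteq> X"
      using finite_row finite_col support that by (auto simp: G_def H_def)
    have "(\<Sum>y\<in>F. (cmod (mat_op M f y))\<^sup>2) = (\<Sum>y\<in>F. (cmod (\<Sum>x\<in>G. M y x * f x))\<^sup>2)"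
      by (rule sum.cong[OF refl], subst mat_op_eq_sum[OF fin(1)]) (auto simp: G_def)
    also have "\<dots> \<le> (\<Sum>y\<in>H. (cmod (\<Sum>x\<in>G. M y x * f x))\<^sup>2)"
      by (rule sum_mono2) (auto simp: fin, simp add: H_def)
    also have "\<dots> = (\<Sum>x\<in>G. (cmod (f x))\<^sup>2)"
      by (rule finite_support_isometric) (auto simp: fin, auto simp: H_def fin)
    also have "\<dots> \<le> sqsum X f" by (rule sum_le_sqsum[OF f fin(1,3)])
    finally show ?thesis .
  qed
  show "mat_op M f \<in> ell2 Y" "sqsum Y (mat_op M f) \<le> sqsum X f"
    using ell2_I[of Y "mat_op M f" "sqsum X f", OF 1 2] by auto
qed

text \<open>Bessel's inequality: expand \<open>0 \<le> \<parallel>g - M h\<parallel>\<^sup>2\<close> where \<open>h\<close> is the restriction of \<open>M\<^sup>* g\<close> to a finite set.\<close>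

lemma mat_op_ctrans_ell2:
  assumes g: "g \<in> ell2 Y"
  shows "mat_op (ctrans M) g \<in> ell2 X"
proof (rule ell2_I(1))
  fix x assume "x \<notin> X"
  hence "M y x = 0" for y using support[of y x] by auto
  thus "mat_op (ctrans M) g x = 0" by (simp add: mat_op_def ctrans_def)
next
  fix F assume F: "finite F" "F \<subseteq> X"
  define H where "H = (\<Union>x\<in>F. {y. M y x \<noteq> 0})"
  have H: "finite H" "H \<subseteq> Y" using F finite_col support by (auto simp: H_def)
  define h where "h = mat_op (ctrans M) g"
  define u where "u y = (\<Sum>x\<in>F. M y x * h x)" for y
  define v where "v = (\<Sum>x\<in>F. (cmod (h x))\<^sup>2)"
  have u: "(\<Sum>y\<in>H. (cmod (u y))\<^sup>2) = v" unfolding u_def v_def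
    by (rule finite_support_isometric) (use F H in \<open>auto simp: H_def\<close>)
  have "(\<Sum>y\<in>H. cnj (u y) * g y) = (\<Sum>y\<in>H. \<Sum>x\<in>F. cnj (h x) * (cnj (M y x) * g y))"
    by (simp add: u_def sum_distrib_left sum_distrib_right mult_ac)
  also have "\<dots> = (\<Sum>x\<in>F. cnj (h x) * (\<Sum>y\<in>H. cnj (M y x) * g y))"
    unfolding sum_distrib_left by (rule sum.swap)
  also have "\<dots> = (\<Sum>x\<in>F. cnj (h x) * h x)"
    by (rule sum.cong[OF refl], subst h_def, subst mat_op_ctrans_cols[OF H(1)]) (auto simp: H_def h_def)
  also have "\<dots> = complex_of_real v"
    by (simp add: v_def of_real_cmod_power2 del: of_real_power)
  finally have "(\<Sum>y\<in>H. Re (cnj (u y) * g y)) = v"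
    by (simp del: complex_cnj_mult times_complex.simps flip: Re_sum)
  moreover have "(cmod (g y - u y))\<^sup>2 = (cmod (g y))\<^sup>2 - 2 * Re (cnj (u y) * g y) + (cmod (u y))\<^sup>2" for y
    unfolding cmod_power2 by (simp add: power2_eq_square algebra_simps)
  ultimately have "(\<Sum>y\<in>H. (cmod (g y - u y))\<^sup>2) = (\<Sum>y\<in>H. (cmod (g y))\<^sup>2) - v"
    by (simp add: sum.distrib sum_subtractf sum_distrib_left[symmetric] u del: complex_cnj_mult times_complex.simps)
  moreover have "0 \<le> (\<Sum>y\<in>H. (cmod (g y - u y))\<^sup>2)" by (rule sum_nonneg) auto
  ultimately have "v \<le> (\<Sum>y\<in>H. (cmod (g y))\<^sup>2)" by linarith
  also have "\<dots> \<le> sqsum Y g" by (rule sum_le_sqsum[OF g H])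
  finally show "(\<Sum>x\<in>F. (cmod (mat_op (ctrans M) g x))\<^sup>2) \<le> sqsum Y g" by (simp add: v_def h_def)
qed

text \<open>For finitely supported vectors the identity is an exchange of finite sums. A general
  \<open>f\<close> is split into a finite part \<open>k\<close> and a remainder \<open>r\<close>;
  since \<open>M\<close> is contractive, \<open>r\<close> contributes at most its norm times that of
  \<open>g\<close>, and the norm of the remainder tends to 0.\<close>

lemma ip_mat_op:
  assumes f: "f \<in> ell2 X" and g: "g \<in> ell2 Y"
  shows "ip Y (mat_op M f) g = ip X f (mat_op (ctrans M) g)"
proof -
  have bound: "cmod ((\<Sum>x\<in>F. cnj (f x) * mat_op (ctrans M) g x) - ip Y (mat_op M f) g)
    \<le> sqrt (sqsum X f - (\<Sum>x\<in>F. (cmod (f x))\<^sup>2)) * sqrt (sqsum Y g)" if F: "finite F" "F \<subseteq> X" for F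
  proof -
    define k where "k x = (if x \<in> F then f x else 0)" for x
    define r where "r x = (if x \<in> X - F then f x else 0)" for x
    have k: "k \<in> ell2 X" unfolding k_def by (rule ell2_finite_support[OF F])
    have r: "r \<in> ell2 X"
      by (rule ell2_I(1)[of _ _ "sqsum X f"], simp add: r_def,
        rule order_trans[OF _ sum_le_sqsum[OF f]]) (auto simp: r_def intro: sum_mono)
    have fkr: "f = (\<lambda>x. k x + r x)" using f by (auto simp: k_def r_def fun_eq_iff ell2D)
    define H where "H = (\<Union>x\<in>F. {y. M y x \<noteq> 0})"
    have H: "finite H" "H \<subseteq> Y" using F finite_col support by (auto simp: H_def)
    have Mk: "mat_op M k y = (\<Sum>x\<in>F. M y x * f x)" for y
    proof -
      have "mat_op M k y = (\<Sum>x\<in>F. M y x * k x)" unfolding mat_op_def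
        by (rule Sum_any.expand_superset[OF F(1)]) (auto simp: k_def)
      thus ?thesis by (simp add: k_def)
    qed
    have "ip Y (mat_op M k) g = (\<Sum>y\<in>H. cnj (mat_op M k y) * g y)"
      by (rule ip_finite_support_left[OF H]) (auto simp: Mk H_def intro!: sum.neutral)
    also have "\<dots> = (\<Sum>y\<in>H. \<Sum>x\<in>F. cnj (f x) * (cnj (M y x) * g y))"
      by (simp add: Mk sum_distrib_left sum_distrib_right mult_ac)
    also have "\<dots> = (\<Sum>x\<in>F. cnj (f x) * (\<Sum>y\<in>H. cnj (M y x) * g y))"
      unfolding sum_distrib_left by (rule sum.swap)
    also have "\<dots> = (\<Sum>x\<in>F. cnj (f x) * mat_op (ctrans M) g x)"
      by (rule sum.cong[OF refl], subst mat_op_ctrans_cols[OF H(1)]) (auto simp: H_def)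
    finally have kk: "ip Y (mat_op M k) g = (\<Sum>x\<in>F. cnj (f x) * mat_op (ctrans M) g x)" .
    have "mat_op M f = (\<lambda>y. mat_op M k y + mat_op M r y)"
      by (subst fkr, rule mat_op_add[OF finite_row])
    hence "ip Y (mat_op M f) g = (\<Sum>x\<in>F. cnj (f x) * mat_op (ctrans M) g x) + ip Y (mat_op M r) g"
      by (simp add: ip_add_left mat_op_ell2 k r g kk)
    hence "cmod ((\<Sum>x\<in>F. cnj (f x) * mat_op (ctrans M) g x) - ip Y (mat_op M f) g) = cmod (ip Y (mat_op M r) g)"
      by simp
    also have "\<dots> \<le> sqrt (sqsum Y (mat_op M r)) * sqrt (sqsum Y g)"
      by (rule Cauchy_Schwarz_ip[OF mat_op_ell2[OF r] g])
    also have "\<dots> \<le> sqrt (sqsum X r) * sqrt (sqsum Y g)"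
      by (intro mult_right_mono real_sqrt_le_mono sqsum_mat_op[OF r]) (simp add: sqsum_nonneg)
    also have "sqsum X r = sqsum X f - (\<Sum>x\<in>F. (cmod (f x))\<^sup>2)"
    proof -
      have "sqsum X f = sqsum F f + sqsum (X - F) f"
        unfolding sqsum_def using F f infsum_Un_disjoint[of "\<lambda>x. (cmod (f x))\<^sup>2" F "X - F"]
        by (simp add: Un_absorb1 ell2D summable_on_subset_banach[of _ X])
      moreover have "sqsum (X - F) f = sqsum X r"
        unfolding sqsum_def by (rule infsum_cong_neutral) (auto simp: r_def)
      ultimately show ?thesis using F by (simp add: sqsum_def)
    qed
    finally show ?thesis .
  qed
  have "((\<lambda>F. sqrt (sqsum X f - (\<Sum>x\<in>F. (cmod (f x))\<^sup>2)) * sqrt (sqsum Y g)) \<longlongrightarrow>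
     sqrt (sqsum X f - sqsum X f) * sqrt (sqsum Y g)) (finite_subsets_at_top X)"
    using infsum_tendsto[OF ell2D(2)[OF f]]
    by (intro tendsto_intros) (simp add: sqsum_def)
  hence lim: "((\<lambda>F. sqrt (sqsum X f - (\<Sum>x\<in>F. (cmod (f x))\<^sup>2)) * sqrt (sqsum Y g)) \<longlongrightarrow> 0)
     (finite_subsets_at_top X)" by simp
  have "((\<lambda>F. (\<Sum>x\<in>F. cnj (f x) * mat_op (ctrans M) g x) - ip Y (mat_op M f) g) \<longlongrightarrow> 0)
     (finite_subsets_at_top X)"
    by (rule Lim_null_comparison[OF _ lim]) (auto intro!: eventually_finite_subsets_at_top_weakI bound)
  hence "((\<lambda>x. cnj (f x) * mat_op (ctrans M) g x) has_sum ip Y (mat_op M f) g) X"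
    unfolding has_sum_def by (rule LIM_zero_cancel)
  thus ?thesis unfolding ip_def by (simp add: infsumI)
qed

text \<open>Agreement on \<open>ell2 X\<close> is enough, since the adjoint inspects
  \<open>A\<close> only there; a denotation and its matrix may differ elsewhere.\<close>

lemma adj_mat_op:
  assumes "g \<in> ell2 Y" "\<And>f. f \<in> ell2 X \<Longrightarrow> A f = mat_op M f"
  shows "adj X Y A g = mat_op (ctrans M) g"
  by (rule adj_eqI) (use assms in \<open>auto simp: mat_op_ctrans_ell2 ip_mat_op\<close>)

end

text \<open>Isometries into one space with mutually orthogonal ranges, whose range projections add
  up to the identity. The sources \<open>X i\<close> vary because each clause has its own
  context.\<close>

locale isometric_resolution =
  fixes I :: "'i set" and X :: "'i \<Rightarrow> 'a set" and Y :: "'b set" and M :: "'i \<Rightarrow> 'b \<Rightarrow> 'a \<Rightarrow> complex"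
  assumes finite_index: "finite I"
    and iso: "i \<in> I \<Longrightarrow> isometric_matrix (X i) Y (M i)"
    and orthogonal: "i \<in> I \<Longrightarrow> j \<in> I \<Longrightarrow> i \<noteq> j \<Longrightarrow> x \<in> X i \<Longrightarrow> x' \<in> X j \<Longrightarrow>
      Sum_any (\<lambda>y. cnj (M i y x) * M j y x') = 0"
    and complete: "y \<in> Y \<Longrightarrow> y' \<in> Y \<Longrightarrow>
      (\<Sum>i\<in>I. Sum_any (\<lambda>x. M i y x * cnj (M i y' x))) = (if y = y' then 1 else 0)"
begin

lemma mat_op_ctrans_mat_op:
  assumes "i \<in> I" "j \<in> I" "f \<in> ell2 (X j)"
  shows "mat_op (ctrans (M i)) (mat_op (M j) f) = (if i = j then f else (\<lambda>_. 0))"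
proof
  fix x
  interpret i: isometric_matrix "X i" Y "M i" using iso assms by auto
  interpret j: isometric_matrix "X j" Y "M j" using iso assms by auto
  have "Sum_any (\<lambda>y. cnj (M i y x) * M j y z) * f z = (if z = x then if i = j then f x else 0 else 0)" for z
  proof (cases "x \<in> X i \<and> z \<in> X j")
    case True
    thus ?thesis using i.orthonormal[of x z] orthogonal[of i j x z] assms by auto
  next
    \<comment> \<open>When an index leaves its set, the entry is 0 by the support condition; the
      claimed diagonal value is then 0 as well, because \<open>f\<close> vanishes outside
      \<open>X j\<close>.\<close>
    case False
    hence "Sum_any (\<lambda>y. cnj (M i y x) * M j y z) = 0"
    proof -
      have "cnj (M i y x) * M j y z = 0" for y using i.support[of y x] j.support[of y z] False by auto
      thus ?thesis by (rule Sum_any_zero)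
    qed
    thus ?thesis using False assms(3) by (auto simp: ell2D)
  qed
  thus "mat_op (ctrans (M i)) (mat_op (M j) f) x = (if i = j then f else (\<lambda>_. 0)) x"
    by (subst mat_op_mat_op[OF i.finite_row_ctrans j.finite_row]) (simp add: ctrans_def)
qed

lemma sum_mat_op_mat_op_ctrans:
  assumes "g \<in> ell2 Y"
  shows "(\<Sum>i\<in>I. mat_op (M i) (mat_op (ctrans (M i)) g) y) = g y"
proof -
  define P where "P i z = Sum_any (\<lambda>x. M i y x * cnj (M i z x))" for i z
  \<comment> \<open>All positions that row \<open>y\<close> of some range projection can reach,
    finite by row and column finiteness. Inserting \<open>y\<close> lets the final delta sum pick up
    \<open>g y\<close> in every case.\<close>
  define R where "R = insert y (\<Union>i\<in>I. \<Union>x\<in>{x. M i y x \<noteq> 0}. {z. M i z x \<noteq> 0})"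
  have "finite R" using finite_index iso by (auto simp: R_def isometric_matrix_def)
  have P: "P i z = 0" if "i \<in> I" "z \<notin> R" for i z
  proof -
    have "M i y x * cnj (M i z x) = 0" for x using that by (auto simp: R_def)
    thus ?thesis unfolding P_def by (rule Sum_any_zero)
  qed
  have "mat_op (M i) (mat_op (ctrans (M i)) g) y = (\<Sum>z\<in>R. P i z * g z)" if "i \<in> I" for i
  proof -
    interpret i: isometric_matrix "X i" Y "M i" using iso that by auto
    have "mat_op (M i) (mat_op (ctrans (M i)) g) y = Sum_any (\<lambda>z. P i z * g z)"
      by (subst mat_op_mat_op[OF i.finite_row i.finite_row_ctrans]) (simp add: ctrans_def P_def)
    also have "\<dots> = (\<Sum>z\<in>R. P i z * g z)"
      by (rule Sum_any.expand_superset[OF \<open>finite R\<close>]) (use P that in auto)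
    finally show ?thesis .
  qed
  hence "(\<Sum>i\<in>I. mat_op (M i) (mat_op (ctrans (M i)) g) y) = (\<Sum>i\<in>I. \<Sum>z\<in>R. P i z * g z)"
    by (intro sum.cong) auto
  also have "\<dots> = (\<Sum>z\<in>R. (\<Sum>i\<in>I. P i z) * g z)"
    by (subst sum.swap) (simp add: sum_distrib_right)
  also have "\<dots> = (\<Sum>z\<in>R. if z = y then g y else 0)"
  proof (rule sum.cong[OF refl])
    fix z
    show "(\<Sum>i\<in>I. P i z) * g z = (if z = y then g y else 0)"
    proof (cases "y \<in> Y \<and> z \<in> Y")
      case True
      thus ?thesis using complete[of y z] by (auto simp: P_def)
    next
      case False
      show ?thesis
      proof (cases "z \<in> Y")
        case True
        have "P i z = 0" if "i \<in> I" for i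
        proof -
          have "M i y x = 0" for x using False True isometric_matrix.support[OF iso[OF that], of y x] by auto
          thus ?thesis by (auto simp: P_def intro!: Sum_any_zero)
        qed
        thus ?thesis using False True by auto
      qed (use assms in \<open>auto simp: ell2D\<close>)
    qed
  qed
  also have "\<dots> = g y" using \<open>finite R\<close> by (simp add: R_def)
  finally show ?thesis .
qed

end

text \<open>Both families share the index set and the source spaces. Applying the adjoint of
  \<open>A i\<close> to \<open>U f\<close> therefore keeps a single term, the adjoint of
  \<open>B i\<close> applied to \<open>f\<close>; applying the \<open>B i\<close> and summing gives
  back \<open>f\<close> by completeness of \<open>B\<close>. The other composition is
  symmetric.\<close>

lemma unitary_op_resolutions:
  assumes "isometric_resolution I X Y A" "isometric_resolution I X Z B"
    and U: "\<And>g. g \<in> ell2 Z \<Longrightarrow> U g = (\<lambda>y. \<Sum>i\<in>I. mat_op (A i) (mat_op (ctrans (B i)) g) y)"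
  shows "unitary_op Z Y U"
proof -
  interpret A: isometric_resolution I X Y A by fact
  interpret B: isometric_resolution I X Z B by fact
  note A' = A.iso[THEN isometric_matrix.mat_op_ell2] A.iso[THEN isometric_matrix.mat_op_ctrans_ell2]
    A.iso[THEN isometric_matrix.finite_row] A.iso[THEN isometric_matrix.finite_row_ctrans]
  note B' = B.iso[THEN isometric_matrix.mat_op_ell2] B.iso[THEN isometric_matrix.mat_op_ctrans_ell2]
    B.iso[THEN isometric_matrix.finite_row] B.iso[THEN isometric_matrix.finite_row_ctrans]
  let ?U = "\<lambda>g y. \<Sum>i\<in>I. mat_op (A i) (mat_op (ctrans (B i)) g) y"
  let ?V = "\<lambda>g z. \<Sum>i\<in>I. mat_op (B i) (mat_op (ctrans (A i)) g) z"
  have zero: "mat_op N (\<lambda>_. 0) = (\<lambda>_. 0)" for N :: "'x \<Rightarrow> 'y \<Rightarrow> complex" by (simp add: mat_op_def fun_eq_iff)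
  have VU: "?V (?U f) = f" if "f \<in> ell2 Z" for f
  proof -
    have "mat_op (ctrans (A i)) (?U f) = mat_op (ctrans (B i)) f" if "i \<in> I" for i
      using that \<open>f \<in> ell2 Z\<close>
      by (simp add: mat_op_sum A' B' A.mat_op_ctrans_mat_op if_distrib[of "\<lambda>f. f _"] A.finite_index cong: if_cong)
    thus ?thesis using B.sum_mat_op_mat_op_ctrans[OF that] by simp
  qed
  have UV: "?U (?V g) = g" if "g \<in> ell2 Y" for g
  proof -
    have "mat_op (ctrans (B i)) (?V g) = mat_op (ctrans (A i)) g" if "i \<in> I" for i
      using that \<open>g \<in> ell2 Y\<close>
      by (simp add: mat_op_sum A' B' B.mat_op_ctrans_mat_op if_distrib[of "\<lambda>f. f _"] A.finite_index cong: if_cong)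
    thus ?thesis using A.sum_mat_op_mat_op_ctrans[OF that] by simp
  qed
  show ?thesis
  proof (rule unitary_opI[where V = ?V])
    fix f g assume f: "f \<in> ell2 Z" and g: "g \<in> ell2 Y"
    have "ip Y (?U f) g = (\<Sum>i\<in>I. ip Y (mat_op (A i) (mat_op (ctrans (B i)) f)) g)"
      by (rule ip_sum_left) (use A' B' f g in auto)
    also have "\<dots> = (\<Sum>i\<in>I. ip Z f (mat_op (B i) (mat_op (ctrans (A i)) g)))"
    proof (rule sum.cong[OF refl])
      fix i assume i: "i \<in> I"
      interpret Ai: isometric_matrix "X i" Y "A i" using A.iso i by auto
      interpret Bi: isometric_matrix "X i" Z "B i" using B.iso i by auto
      have "ip Y (mat_op (A i) (mat_op (ctrans (B i)) f)) g = ip (X i) (mat_op (ctrans (B i)) f) (mat_op (ctrans (A i)) g)"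
        by (rule Ai.ip_mat_op) (use Bi.mat_op_ctrans_ell2 f g in auto)
      \<comment> \<open>\<open>ip_mat_op\<close> moves a matrix out of the left argument. Here
        \<open>B i\<close> has to return from the right one, so the inner product is conjugated
        before and after.\<close>
      also have "\<dots> = cnj (ip (X i) (mat_op (ctrans (A i)) g) (mat_op (ctrans (B i)) f))" by (simp add: ip_cnj)
      also have "\<dots> = cnj (ip Z (mat_op (B i) (mat_op (ctrans (A i)) g)) f)"
        by (subst Bi.ip_mat_op) (use Ai.mat_op_ctrans_ell2 f g in auto)
      finally show "ip Y (mat_op (A i) (mat_op (ctrans (B i)) f)) g = ip Z f (mat_op (B i) (mat_op (ctrans (A i)) g))"
        by (simp add: ip_cnj)
    qed
    also have "\<dots> = ip Z f (?V g)"
      by (rule ip_sum_right[symmetric]) (use A' B' f g in auto)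
    finally show "ip Y (U f) g = ip Z f (?V g)" by (simp only: U[OF f])
  next
    fix g assume "g \<in> ell2 Y"
    moreover from this have "?V g \<in> ell2 Z" by (auto intro!: ell2_sum simp: A' B')
    ultimately show "U (?V g) = g" by (simp only: U UV)
  next
    fix f g assume fg: "f \<in> ell2 Z" "g \<in> ell2 Z"
    show "U (\<lambda>x. f x + g x) = (\<lambda>y. U f y + U g y)"
      unfolding U[OF ell2_add[OF fg]] U[OF fg(1)] U[OF fg(2)] by (simp add: A' B' mat_op_add sum.distrib)
  next
    fix f c assume f: "f \<in> ell2 Z"
    show "U (\<lambda>x. c * f x) = (\<lambda>y. c * U f y)"
      unfolding U[OF ell2_cmult[OF f]] U[OF f] by (simp add: A' B' mat_op_scale sum_distrib_left)
  qed (use VU in \<open>auto intro!: ell2_sum simp: A' B' U\<close>)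
qed

section \<open>Matrices of expressions\<close>

text \<open>No finiteness is assumed: the supports correspond under \<open>h\<close>, so they are
  infinite together, and then both sums are 0.\<close>

lemma Sum_any_reindex_inj:
  assumes "inj h" "\<And>a. g a \<noteq> 0 \<Longrightarrow> a \<in> range h"
  shows "Sum_any g = Sum_any (\<lambda>b. g (h b))"
proof -
  have "{a. g a \<noteq> 0} = h ` {b. g (h b) \<noteq> 0}" using assms(2) by auto
  thus ?thesis
    using assms(1) by (simp add: Sum_any.expand_set sum.reindex inj_on_def)
qed

lemma Sum_any_eq_double_sum:
  assumes "finite P" "finite R" "\<And>a b. F a b \<noteq> 0 \<Longrightarrow> a \<in> P \<and> b \<in> R"
  shows "Sum_any (\<lambda>a. Sum_any (F a)) = (\<Sum>a\<in>P. \<Sum>b\<in>R. F a b)"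
proof -
  have "Sum_any (F a) = (\<Sum>b\<in>R. F a b)" for a
    by (rule Sum_any.expand_superset) (use assms in auto)
  thus ?thesis
    by simp (rule Sum_any.expand_superset, use assms in \<open>auto elim!: sum.not_neutral_contains_not_neutral\<close>)
qed

section \<open>Splitting of partial assignments\<close>

lemma restrict_map_add:
  assumes "dom \<sigma> \<subseteq> A" "dom \<tau> \<subseteq> B" "A \<inter> B = {}"
  shows "(\<sigma> ++ \<tau>) |` A = \<sigma>" "(\<sigma> ++ \<tau>) |` B = \<tau>"
proof -
  have "\<sigma> x = None" if "x \<notin> A" for x using assms that by (auto simp: dom_def)
  moreover have "\<tau> x = None" if "x \<notin> B" for x using assms that by (auto simp: dom_def)
  ultimately show "(\<sigma> ++ \<tau>) |` A = \<sigma>" "(\<sigma> ++ \<tau>) |` B = \<tau>" using assms(3)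
    by (auto simp: fun_eq_iff restrict_map_def map_add_def disjoint_iff split: option.splits)
qed

lemma map_add_restrict:
  assumes "dom \<sigma> \<subseteq> A \<union> B"
  shows "\<sigma> |` A ++ \<sigma> |` B = \<sigma>"
proof
  fix x
  show "(\<sigma> |` A ++ \<sigma> |` B) x = \<sigma> x"
    using assms by (cases "\<sigma> x") (auto simp: restrict_map_def map_add_def split: option.splits)
qed

text \<open>Fubini for assignments: those with domain inside \<open>A \<union> B\<close> correspond,
  by restriction and \<open>++\<close>, to pairs of assignments inside \<open>A\<close> and
  \<open>B\<close>. The domain guard excludes assignments with further variables, which would
  restrict to the same pair. It serves both the denotation and the rows of tensors.\<close>

lemma Sum_any_map_add:
  assumes "A \<inter> B = {}" "finite P" "finite R"
    and F: "\<And>\<sigma> \<tau>. F \<sigma> \<tau> \<noteq> 0 \<Longrightarrow> \<sigma> \<in> P \<and> \<tau> \<in> R \<and> dom \<sigma> \<subseteq> A \<and> dom \<tau> \<subseteq> B"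
  shows "Sum_any (\<lambda>\<sigma>. if dom \<sigma> \<subseteq> A \<union> B then F (\<sigma> |` A) (\<sigma> |` B) else 0) = Sum_any (\<lambda>\<sigma>. Sum_any (F \<sigma>))"
proof -
  define C where "C = {\<sigma>\<in>P. dom \<sigma> \<subseteq> A} \<times> {\<tau>\<in>R. dom \<tau> \<subseteq> B}"
  have restrict: "(\<sigma> ++ \<tau>) |` A = \<sigma>" "(\<sigma> ++ \<tau>) |` B = \<tau>" "dom (\<sigma> ++ \<tau>) \<subseteq> A \<union> B" if "(\<sigma>, \<tau>) \<in> C" for \<sigma> \<tau>
    using that restrict_map_add[of \<sigma> A \<tau> B] assms(1) unfolding C_def by auto
  have finC: "finite C" using assms by (simp add: C_def)
  have inj: "inj_on (\<lambda>(\<sigma>, \<tau>). \<sigma> ++ \<tau>) C"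
    by (rule inj_onI) (metis (no_types, lifting) case_prod_conv restrict(1,2) surj_pair)
  have "Sum_any (\<lambda>\<sigma>. if dom \<sigma> \<subseteq> A \<union> B then F (\<sigma> |` A) (\<sigma> |` B) else 0)
    = (\<Sum>\<sigma>\<in>(\<lambda>(\<sigma>, \<tau>). \<sigma> ++ \<tau>) ` C. if dom \<sigma> \<subseteq> A \<union> B then F (\<sigma> |` A) (\<sigma> |` B) else 0)"
  proof (rule Sum_any.expand_superset)
    show "finite ((\<lambda>(\<sigma>, \<tau>). \<sigma> ++ \<tau>) ` C)" using finC by simp
    have "\<sigma> \<in> (\<lambda>(\<sigma>, \<tau>). \<sigma> ++ \<tau>) ` C" if "dom \<sigma> \<subseteq> A \<union> B" "F (\<sigma> |` A) (\<sigma> |` B) \<noteq> 0" for \<sigma>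
    proof -
      have "\<sigma> = \<sigma> |` A ++ \<sigma> |` B"
        using map_add_restrict[OF that(1)] by simp
      moreover have "(\<sigma> |` A, \<sigma> |` B) \<in> C" using F[OF that(2)] by (auto simp: C_def)
      ultimately show ?thesis by (metis (mono_tags, lifting) case_prod_conv image_eqI)
    qed
    thus "{\<sigma>. (if dom \<sigma> \<subseteq> A \<union> B then F (\<sigma> |` A) (\<sigma> |` B) else 0) \<noteq> 0} \<subseteq> (\<lambda>(\<sigma>, \<tau>). \<sigma> ++ \<tau>) ` C"
      by (auto split: if_splits)
  qed
  also have "\<dots> = (\<Sum>(\<sigma>, \<tau>)\<in>C. F \<sigma> \<tau>)"
    by (subst sum.reindex[OF inj], rule sum.cong[OF refl])
      (clarsimp simp: restrict simp del: dom_map_add)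
  also have "\<dots> = (\<Sum>\<sigma>\<in>{\<sigma>\<in>P. dom \<sigma> \<subseteq> A}. \<Sum>\<tau>\<in>{\<tau>\<in>R. dom \<tau> \<subseteq> B}. F \<sigma> \<tau>)"
    unfolding C_def by (rule sum.cartesian_product[symmetric])
  also have "\<dots> = Sum_any (\<lambda>\<sigma>. Sum_any (F \<sigma>))"
    by (rule Sum_any_eq_double_sum[symmetric]) (use assms in auto)
  finally show ?thesis .
qed

section \<open>Basis assignments of contexts\<close>

lemma cbasis_empty: "cbasis Map.empty = {Map.empty}"
  by (auto simp: cbasis_def)

lemma cbasis_single: "\<sigma> \<in> cbasis [x \<mapsto> Q] \<longleftrightarrow> (\<exists>l\<in>qbasis Q. \<sigma> = [x \<mapsto> l])"
proof
  assume "\<sigma> \<in> cbasis [x \<mapsto> Q]"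
  hence *: "dom \<sigma> = {x}" "\<forall>l. \<sigma> x = Some l \<longrightarrow> l \<in> qbasis Q" by (auto simp: cbasis_def)
  then obtain l where "\<sigma> = [x \<mapsto> l]" by (metis dom_eq_singleton_conv)
  thus "\<exists>l\<in>qbasis Q. \<sigma> = [x \<mapsto> l]" using * by auto
qed (auto simp: cbasis_def split: if_splits)

lemma cbasis_dom: "\<sigma> \<in> cbasis \<Gamma> \<Longrightarrow> dom \<sigma> = dom \<Gamma>"
  by (simp add: cbasis_def)

lemma cbasis_map_add:
  assumes "dom \<Gamma>1 \<inter> dom \<Gamma>2 = {}"
  shows "\<sigma> \<in> cbasis (\<Gamma>1 ++ \<Gamma>2) \<longleftrightarrow>
    dom \<sigma> \<subseteq> dom \<Gamma>1 \<union> dom \<Gamma>2 \<and> \<sigma> |` dom \<Gamma>1 \<in> cbasis \<Gamma>1 \<and> \<sigma> |` dom \<Gamma>2 \<in> cbasis \<Gamma>2"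
proof -
  have D: "dom \<sigma> = dom (\<Gamma>1 ++ \<Gamma>2) \<longleftrightarrow>
    dom \<sigma> \<subseteq> dom \<Gamma>1 \<union> dom \<Gamma>2 \<and> dom (\<sigma> |` dom \<Gamma>1) = dom \<Gamma>1 \<and> dom (\<sigma> |` dom \<Gamma>2) = dom \<Gamma>2" by auto
  have L: "(\<forall>x Q l. (\<Gamma>1 ++ \<Gamma>2) x = Some Q \<longrightarrow> \<sigma> x = Some l \<longrightarrow> l \<in> qbasis Q) \<longleftrightarrow>
    (\<forall>x Q l. \<Gamma>1 x = Some Q \<longrightarrow> (\<sigma> |` dom \<Gamma>1) x = Some l \<longrightarrow> l \<in> qbasis Q) \<and>
    (\<forall>x Q l. \<Gamma>2 x = Some Q \<longrightarrow> (\<sigma> |` dom \<Gamma>2) x = Some l \<longrightarrow> l \<in> qbasis Q)"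
  proof -
    have "(\<Gamma>1 ++ \<Gamma>2) x = Some Q \<longleftrightarrow> \<Gamma>1 x = Some Q \<or> \<Gamma>2 x = Some Q" for x Q
      using assms unfolding map_add_Some_iff disjoint_iff domIff by (cases "\<Gamma>2 x") auto
    moreover have "(\<forall>x Q l. \<Gamma> x = Some Q \<longrightarrow> (\<sigma> |` dom \<Gamma>) x = Some l \<longrightarrow> l \<in> qbasis Q) \<longleftrightarrow>
        (\<forall>x Q l. \<Gamma> x = Some Q \<longrightarrow> \<sigma> x = Some l \<longrightarrow> l \<in> qbasis Q)" for \<Gamma> :: ctx
      by (simp add: restrict_map_def domI cong: imp_cong)
    ultimately show ?thesis by blast
  qed
  show ?thesis unfolding cbasis_def mem_Collect_eq D L by (simp only: conj_ac)
qed

section \<open>Inversion of typing and uniqueness of contexts\<close>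

lemma typed_lin_invert:
  assumes "typed \<Gamma> (lin I \<alpha> t) Q" "finite I"
  shows "\<forall>i\<in>I. typed \<Gamma> (t i) Q"
  using assms(1)
proof (cases rule: typed.cases)
  case (typed_lin J e \<beta>)
  \<comment> \<open>A sum is a multiset, so inversion returns another presentation by
    \<open>J\<close>, \<open>\<beta>\<close>, \<open>e\<close>. Its terms form the same set, which
    is enough for typing.\<close>
  have "snd ` set_mset (image_mset (\<lambda>i. (\<alpha> i, t i)) (mset_set I)) =
    snd ` set_mset (image_mset (\<lambda>i. (\<beta> i, e i)) (mset_set J))"
    using typed_lin(1) by (simp add: lin_def)
  hence "t ` I = e ` J" using assms(2) typed_lin(2) by (simp add: image_image)
  thus ?thesis using typed_lin(3) by (metis imageE imageI)
qed (auto simp: lin_def)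

lemma typed_ETensE:
  assumes "typed \<Gamma> (ETens e1 e2) Q"
  obtains \<Gamma>1 \<Gamma>2 Q1 Q2 where "Q = QTens Q1 Q2" "\<Gamma> = \<Gamma>1 ++ \<Gamma>2"
    "typed \<Gamma>1 e1 Q1" "typed \<Gamma>2 e2 Q2" "dom \<Gamma>1 \<inter> dom \<Gamma>2 = {}"
  using assms by (cases rule: typed.cases) (auto simp: lin_def)

lemma typed_EInlE:
  assumes "typed \<Gamma> (EInl e) Q"
  obtains Q1 Q2 where "Q = QPlus Q1 Q2" "typed \<Gamma> e Q1"
  using assms by (cases rule: typed.cases) (auto simp: lin_def)

lemma typed_EInrE:
  assumes "typed \<Gamma> (EInr e) Q"
  obtains Q1 Q2 where "Q = QPlus Q1 Q2" "typed \<Gamma> e Q2"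
  using assms by (cases rule: typed.cases) (auto simp: lin_def)

lemma typed_ESucD: "typed \<Gamma> (ESuc e) Q \<Longrightarrow> Q = QNat \<and> typed \<Gamma> e QNat"
  by (cases rule: typed.cases) (auto simp: lin_def)

lemma typed_EStarD: "typed \<Gamma> EStar Q \<Longrightarrow> \<Gamma> = Map.empty"
  by (cases rule: typed.cases) (auto simp: lin_def)

lemma typed_EZeroD: "typed \<Gamma> EZero Q \<Longrightarrow> \<Gamma> = Map.empty"
  by (cases rule: typed.cases) (auto simp: lin_def)

lemma typed_EVarD: "typed \<Gamma> (EVar x) Q \<Longrightarrow> \<Gamma> = [x \<mapsto> Q]"
  by (cases rule: typed.cases) (auto simp: lin_def)

text \<open>Linear use fixes the variables, and the type of the whole propagates down to fix the
  type of each. This makes the assignments of equal tensors split along the same domains.\<close>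

lemma typed_unique: "typed \<Gamma> e Q \<Longrightarrow> typed \<Gamma>' e Q \<Longrightarrow> \<Gamma> = \<Gamma>'"
proof (induction arbitrary: \<Gamma>' rule: typed.induct)
  case (typed_lin I \<Gamma> e Q \<alpha>)
  \<comment> \<open>The squared moduli add up to 1, so the sum has at least one term to
    inspect.\<close>
  obtain i where "i \<in> I" using typed_lin.hyps by fastforce
  thus ?case using typed_lin typed_lin_invert[of \<Gamma>' I \<alpha> e Q] by blast
next
  case (typed_tens \<Gamma>1 e1 Q1 \<Gamma>2 e2 Q2)
  from typed_tens.prems show ?case
  proof (rule typed_ETensE)
    fix \<Delta>1 \<Delta>2 R1 R2
    assume "QTens Q1 Q2 = QTens R1 R2" "\<Gamma>' = \<Delta>1 ++ \<Delta>2" "typed \<Delta>1 e1 R1" "typed \<Delta>2 e2 R2"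
    thus ?thesis using typed_tens.IH(1)[of \<Delta>1] typed_tens.IH(2)[of \<Delta>2] by simp
  qed
next
  case (typed_inl \<Gamma> e Q1 Q2)
  from typed_inl.prems show ?case by (rule typed_EInlE) (rule typed_inl.IH, simp)
next
  case (typed_inr \<Gamma> e Q1 Q2)
  from typed_inr.prems show ?case by (rule typed_EInrE) (rule typed_inr.IH, simp)
next
  case (typed_suc \<Gamma> e)
  show ?case by (rule typed_suc.IH) (use typed_suc.prems typed_ESucD in blast)
qed (rule typed_EStarD[symmetric] typed_EZeroD[symmetric] typed_EVarD[symmetric], assumption)+

text \<open>Unlike \<open>den\<close>, the matrix entries do not refer to a context: the assignment \<open>\<sigma>\<close> carries its own
  domain. The price is that entries may be nonzero outside the space of the type, as for \<open>EVar\<close>;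
  by \<open>emat_support\<close> below this happens only for assignments outside \<open>cbasis \<Gamma>\<close>.\<close>

primrec emat :: "expr \<Rightarrow> lab \<Rightarrow> (var \<rightharpoonup> lab) \<Rightarrow> complex" where
  "emat EStar = (\<lambda>l \<sigma>. if l = LUnit \<and> \<sigma> = Map.empty then 1 else 0)"
| "emat (EVar x) = (\<lambda>l \<sigma>. if \<sigma> = [x \<mapsto> l] then 1 else 0)"
| "emat (EInl e) = (\<lambda>l \<sigma>. case l of LInl p \<Rightarrow> emat e p \<sigma> | _ \<Rightarrow> 0)"
| "emat (EInr e) = (\<lambda>l \<sigma>. case l of LInr p \<Rightarrow> emat e p \<sigma> | _ \<Rightarrow> 0)"
| "emat (ETens e e') = (\<lambda>l \<sigma>. case l of LPair p q \<Rightarrow>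
     if dom \<sigma> \<subseteq> fv e \<union> fv e' then emat e p (\<sigma> |` fv e) * emat e' q (\<sigma> |` fv e') else 0 | _ \<Rightarrow> 0)"
| "emat EZero = (\<lambda>l \<sigma>. if l = LNat 0 \<and> \<sigma> = Map.empty then 1 else 0)"
| "emat (ESuc e) = (\<lambda>l \<sigma>. case l of LNat (Suc n) \<Rightarrow> emat e (LNat n) \<sigma> | _ \<Rightarrow> 0)"
| "emat (ELin M) = (\<lambda>l \<sigma>. \<Sum>p\<in>#image_mset (map_prod id emat) M. fst p * snd p l \<sigma>)"

lemma emat_lin: "emat (lin I \<alpha> t) l \<sigma> = (\<Sum>i\<in>I. \<alpha> i * emat (t i) l \<sigma>)"
  by (simp add: lin_def sum_unfold_sum_mset image_mset.compositionality comp_def)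

text \<open>An equivalence is what the induction can carry: a variable relates every label
  \<open>l\<close> to \<open>[x \<mapsto> l]\<close> regardless of types, so at a nonzero entry both
  indices are in range or neither is. One direction confines labels once assignments are restricted
  to the context basis, the other confines assignments once labels are restricted.\<close>

lemma emat_support:
  assumes "typed \<Gamma> e Q" "emat e l \<sigma> \<noteq> 0"
  shows "dom \<sigma> = dom \<Gamma> \<and> (l \<in> qbasis Q \<longleftrightarrow> \<sigma> \<in> cbasis \<Gamma>)"
  using assms
proof (induction arbitrary: l \<sigma> rule: typed.induct)
  case typed_star
  thus ?case by (auto simp: cbasis_empty split: if_splits)
next
  case (typed_var x Q)
  hence \<sigma>: "\<sigma> = [x \<mapsto> l]" by (simp split: if_splits)
  have "\<sigma> \<in> cbasis [x \<mapsto> Q] \<longleftrightarrow> l \<in> qbasis Q"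
    unfolding cbasis_single \<sigma> by (blast dest: map_upd_eqD1)
  moreover have "dom \<sigma> = dom [x \<mapsto> Q]" unfolding \<sigma> dom_fun_upd by simp
  ultimately show ?case by blast
next
  case (typed_tens \<Gamma>1 e1 Q1 \<Gamma>2 e2 Q2)
  from typed_tens.prems obtain p q where l: "l = LPair p q" by (auto split: lab.splits)
  have *: "dom \<sigma> \<subseteq> dom \<Gamma>1 \<union> dom \<Gamma>2" "emat e1 p (\<sigma> |` dom \<Gamma>1) \<noteq> 0" "emat e2 q (\<sigma> |` dom \<Gamma>2) \<noteq> 0"
    using typed_tens.prems typed_tens.hyps by (auto simp: l typed_fv split: if_splits)
  have "dom \<sigma> = dom (\<Gamma>1 ++ \<Gamma>2)"
    using *(1) typed_tens.IH(1)[OF *(2)] typed_tens.IH(2)[OF *(3)] by auto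
  thus ?case
    using typed_tens.IH(1)[OF *(2)] typed_tens.IH(2)[OF *(3)] *(1)
    by (auto simp: l cbasis_map_add[OF typed_tens.hyps(3)])
next
  case (typed_lin I \<Gamma> e Q \<alpha>)
  then obtain i where "i \<in> I" "emat (e i) l \<sigma> \<noteq> 0"
    by (auto simp: emat_lin elim!: sum.not_neutral_contains_not_neutral)
  thus ?case using typed_lin.IH by blast
next
  case (typed_inl \<Gamma> e Q1 Q2)
  from typed_inl.prems obtain p where "l = LInl p" by (cases l) auto
  thus ?case using typed_inl.IH[of p \<sigma>] typed_inl.prems by auto
next
  case (typed_inr \<Gamma> e Q1 Q2)
  from typed_inr.prems obtain p where "l = LInr p" by (cases l) auto
  thus ?case using typed_inr.IH[of p \<sigma>] typed_inr.prems by auto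
next
  case (typed_suc \<Gamma> e)
  from typed_suc.prems obtain n where "l = LNat (Suc n)" by (cases l) (auto split: nat.splits)
  thus ?case using typed_suc.IH[of "LNat n" \<sigma>] typed_suc.prems by auto
next
  case typed_zero
  thus ?case by (simp add: cbasis_empty split: if_splits)
qed

section \<open>Finiteness of rows and columns\<close>

lemma emat_finite_row: "typed \<Gamma> e Q \<Longrightarrow> finite {\<sigma>. emat e l \<sigma> \<noteq> 0}"
proof (induction arbitrary: l rule: typed.induct)
  case (typed_tens \<Gamma>1 e1 Q1 \<Gamma>2 e2 Q2)
  show ?case
  proof (cases l)
    case (LPair p q)
    \<comment> \<open>The domain guard in the tensor entries makes \<open>\<sigma>\<close> the union
      of its two restrictions, so the row is covered by a product of two finite rows.\<close>
    have "\<sigma> \<in> (\<lambda>(\<sigma>, \<tau>). \<sigma> ++ \<tau>) ` ({\<sigma>. emat e1 p \<sigma> \<noteq> 0} \<times> {\<sigma>. emat e2 q \<sigma> \<noteq> 0})"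
      if "emat (ETens e1 e2) l \<sigma> \<noteq> 0" for \<sigma>
    proof -
      have "dom \<sigma> \<subseteq> fv e1 \<union> fv e2" "emat e1 p (\<sigma> |` fv e1) \<noteq> 0" "emat e2 q (\<sigma> |` fv e2) \<noteq> 0"
        using that LPair by (simp_all split: if_splits)
      thus ?thesis
        by (intro image_eqI[of _ _ "(\<sigma> |` fv e1, \<sigma> |` fv e2)"]) (simp_all add: map_add_restrict)
    qed
    hence "{\<sigma>. emat (ETens e1 e2) l \<sigma> \<noteq> 0} \<subseteq>
      (\<lambda>(\<sigma>, \<tau>). \<sigma> ++ \<tau>) ` ({\<sigma>. emat e1 p \<sigma> \<noteq> 0} \<times> {\<sigma>. emat e2 q \<sigma> \<noteq> 0})" by blast
    thus ?thesis by (rule finite_subset) (intro finite_imageI finite_cartesian_product typed_tens.IH)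
  qed auto
next
  case (typed_lin I \<Gamma> e Q \<alpha>)
  have "{\<sigma>. emat (lin I \<alpha> e) l \<sigma> \<noteq> 0} \<subseteq> (\<Union>i\<in>I. {\<sigma>. emat (e i) l \<sigma> \<noteq> 0})"
    by (auto simp: emat_lin elim!: sum.not_neutral_contains_not_neutral)
  thus ?case using typed_lin by (auto elim: finite_subset)
next
  case (typed_inl \<Gamma> e Q1 Q2)
  thus ?case by (cases l) auto
next
  case (typed_inr \<Gamma> e Q1 Q2)
  thus ?case by (cases l) auto
next
  case (typed_suc \<Gamma> e)
  show ?case
  proof (cases l)
    case (LNat n)
    thus ?thesis using typed_suc.IH by (cases n) auto
  qed auto
qed auto

lemma emat_finite_col: "typed \<Gamma> e Q \<Longrightarrow> finite {l. emat e l \<sigma> \<noteq> 0}"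
proof (induction arbitrary: \<sigma> rule: typed.induct)
  case (typed_var x Q)
  \<comment> \<open>The label is read off from the assignment. If \<open>\<sigma> x\<close> is
    undefined, the left side is empty and the unspecified value of \<open>the\<close> does no
    harm.\<close>
  have "{l. emat (EVar x) l \<sigma> \<noteq> 0} \<subseteq> {the (\<sigma> x)}" by auto
  thus ?case by (rule finite_subset) auto
next
  case (typed_inl \<Gamma> e Q1 Q2)
  have "{l. emat (EInl e) l \<sigma> \<noteq> 0} \<subseteq> LInl ` {l. emat e l \<sigma> \<noteq> 0}" 
  proof
    fix l assume "l \<in> {l. emat (EInl e) l \<sigma> \<noteq> 0}"
    thus "l \<in> LInl ` {l. emat e l \<sigma> \<noteq> 0}" by (cases l) auto
  qed
  thus ?case using typed_inl by (auto elim: finite_subset)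
next
  case (typed_inr \<Gamma> e Q1 Q2)
  have "{l. emat (EInr e) l \<sigma> \<noteq> 0} \<subseteq> LInr ` {l. emat e l \<sigma> \<noteq> 0}" 
  proof
    fix l assume "l \<in> {l. emat (EInr e) l \<sigma> \<noteq> 0}"
    thus "l \<in> LInr ` {l. emat e l \<sigma> \<noteq> 0}" by (cases l) auto
  qed
  thus ?case using typed_inr by (auto elim: finite_subset)
next
  case (typed_suc \<Gamma> e)
  have "{l. emat (ESuc e) l \<sigma> \<noteq> 0} \<subseteq> (\<lambda>l. case l of LNat n \<Rightarrow> LNat (Suc n)) ` {l. emat e l \<sigma> \<noteq> 0}"
  proof
    fix l assume *: "l \<in> {l. emat (ESuc e) l \<sigma> \<noteq> 0}"
    then obtain n where "l = LNat (Suc n)" by (cases l) (auto split: nat.splits)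
    thus "l \<in> (\<lambda>l. case l of LNat n \<Rightarrow> LNat (Suc n)) ` {l. emat e l \<sigma> \<noteq> 0}"
      using * by (auto intro!: rev_image_eqI)
  qed
  thus ?case using typed_suc by (auto elim: finite_subset)
next
  case (typed_tens \<Gamma>1 e1 Q1 \<Gamma>2 e2 Q2)
  have "{l. emat (ETens e1 e2) l \<sigma> \<noteq> 0} \<subseteq>
    (\<lambda>(p, q). LPair p q) ` ({l. emat e1 l (\<sigma> |` fv e1) \<noteq> 0} \<times> {l. emat e2 l (\<sigma> |` fv e2) \<noteq> 0})"
  proof
    fix l assume "l \<in> {l. emat (ETens e1 e2) l \<sigma> \<noteq> 0}"
    thus "l \<in> (\<lambda>(p, q). LPair p q) ` ({l. emat e1 l (\<sigma> |` fv e1) \<noteq> 0} \<times> {l. emat e2 l (\<sigma> |` fv e2) \<noteq> 0})"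
      by (cases l) (auto split: if_splits)
  qed
  thus ?case using typed_tens.IH by (auto elim: finite_subset)
next
  case (typed_lin I \<Gamma> e Q \<alpha>)
  have "{l. emat (lin I \<alpha> e) l \<sigma> \<noteq> 0} \<subseteq> (\<Union>i\<in>I. {l. emat (e i) l \<sigma> \<noteq> 0})"
    by (auto simp: emat_lin elim!: sum.not_neutral_contains_not_neutral)
  thus ?case using typed_lin by (auto elim: finite_subset)
qed auto

text \<open>Vanishing outside the basis is assumed in place of square-summability: in the tensor
  case the induction hypotheses are applied to the fibres and to the function collecting their
  values, and vanishing passes to these at once.\<close>

lemma den_eq_mat_op:
  assumes "typed \<Gamma> e Q" "\<And>\<sigma>. \<sigma> \<notin> cbasis \<Gamma> \<Longrightarrow> f \<sigma> = 0"
  shows "den e \<Gamma> f = mat_op (emat e) f"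
  using assms
proof (induction arbitrary: f rule: typed.induct)
  case typed_star
  have "mat_op (emat EStar) f l = (\<Sum>\<sigma>\<in>{Map.empty}. emat EStar l \<sigma> * f \<sigma>)" for l
    by (rule mat_op_eq_sum) (auto split: if_splits)
  thus ?case by (simp add: fun_eq_iff)
next
  case typed_zero
  have "mat_op (emat EZero) f l = (\<Sum>\<sigma>\<in>{Map.empty}. emat EZero l \<sigma> * f \<sigma>)" for l
    by (rule mat_op_eq_sum) (auto split: if_splits)
  thus ?case by (simp add: fun_eq_iff)
next
  case (typed_var x Q)
  have "mat_op (emat (EVar x)) f l = (\<Sum>\<sigma>\<in>{[x \<mapsto> l]}. emat (EVar x) l \<sigma> * f \<sigma>)" for l
    by (rule mat_op_eq_sum) (auto split: if_splits)
  thus ?case by (simp add: fun_eq_iff[of "den _ _ _"])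
next
  case (typed_inl \<Gamma> e Q1 Q2)
  hence "inl_op (den e \<Gamma> f) l = mat_op (emat (EInl e)) f l" for l
    by (cases l) (simp_all add: inl_op_def mat_op_def)
  thus ?case by (simp add: fun_eq_iff[of "inl_op _"])
next
  case (typed_inr \<Gamma> e Q1 Q2)
  hence "inr_op (den e \<Gamma> f) l = mat_op (emat (EInr e)) f l" for l
    by (cases l) (simp_all add: inr_op_def mat_op_def)
  thus ?case by (simp add: fun_eq_iff[of "inr_op _"])
next
  case (typed_suc \<Gamma> e)
  hence "succ_op (den e \<Gamma> f) l = mat_op (emat (ESuc e)) f l" for l
    by (cases l) (simp_all add: succ_op_def mat_op_def split: nat.split)
  thus ?case by (simp add: fun_eq_iff[of "succ_op _"])
next
  case (typed_lin I \<Gamma> e Q \<alpha>)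
  have fin: "finite (\<Union>i\<in>I. {\<sigma>. emat (e i) l \<sigma> \<noteq> 0})" for l
    using typed_lin emat_finite_row by blast
  have "mat_op (emat (lin I \<alpha> e)) f l = (\<Sum>i\<in>I. \<alpha> i * mat_op (emat (e i)) f l)" for l
  proof -
    define R where "R = (\<Union>i\<in>I. {\<sigma>. emat (e i) l \<sigma> \<noteq> 0})"
    have "mat_op (emat (lin I \<alpha> e)) f l = (\<Sum>\<sigma>\<in>R. (\<Sum>i\<in>I. \<alpha> i * emat (e i) l \<sigma>) * f \<sigma>)"
      unfolding emat_lin[symmetric] R_def
      by (rule mat_op_eq_sum[OF fin]) (auto simp: emat_lin elim!: sum.not_neutral_contains_not_neutral)
    also have "\<dots> = (\<Sum>i\<in>I. \<alpha> i * (\<Sum>\<sigma>\<in>R. emat (e i) l \<sigma> * f \<sigma>))"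
      unfolding sum_distrib_left sum_distrib_right by (subst sum.swap) (simp add: mult.assoc)
    also have "\<dots> = (\<Sum>i\<in>I. \<alpha> i * mat_op (emat (e i)) f l)"
    proof (rule sum.cong[OF refl])
      fix i assume "i \<in> I"
      hence "mat_op (emat (e i)) f l = (\<Sum>\<sigma>\<in>R. emat (e i) l \<sigma> * f \<sigma>)"
        unfolding R_def by (intro mat_op_eq_sum[OF fin]) auto
      thus "\<alpha> i * (\<Sum>\<sigma>\<in>R. emat (e i) l \<sigma> * f \<sigma>) = \<alpha> i * mat_op (emat (e i)) f l" by simp
    qed
    finally show ?thesis .
  qed
  thus ?case using typed_lin by (simp add: den_lin fun_eq_iff)
next
  case (typed_tens \<Gamma>1 e1 Q1 \<Gamma>2 e2 Q2)
  let ?A = "dom \<Gamma>1" and ?B = "dom \<Gamma>2"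
  define h where "h = ctx_split \<Gamma>1 \<Gamma>2 f"
  have fv: "fv e1 = ?A" "fv e2 = ?B" using typed_tens.hyps typed_fv by auto
  have h: "h (\<sigma>, \<tau>) = f (\<sigma> ++ \<tau>)" if "dom \<sigma> = ?A" "dom \<tau> = ?B" for \<sigma> \<tau>
  proof (cases "\<sigma> \<in> cbasis \<Gamma>1 \<and> \<tau> \<in> cbasis \<Gamma>2")
    case False
    have "(\<sigma> ++ \<tau>) |` ?A = \<sigma>" "(\<sigma> ++ \<tau>) |` ?B = \<tau>"
      using restrict_map_add[of \<sigma> ?A \<tau> ?B] that typed_tens.hyps(3) by blast+
    hence "\<sigma> ++ \<tau> \<notin> cbasis (\<Gamma>1 ++ \<Gamma>2)" using False by (auto simp: cbasis_map_add[OF typed_tens.hyps(3)])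
    thus ?thesis using False typed_tens.prems by (simp add: h_def ctx_split_def)
  qed (simp add: h_def ctx_split_def)
  have inner: "den e2 \<Gamma>2 (\<lambda>\<tau>. h (\<sigma>, \<tau>)) q = Sum_any (\<lambda>\<tau>. emat e2 q \<tau> * h (\<sigma>, \<tau>))" for \<sigma> q
    by (subst typed_tens.IH(2)) (auto simp: h_def ctx_split_def mat_op_def)
  have "den e1 \<Gamma>1 (\<lambda>\<sigma>. den e2 \<Gamma>2 (\<lambda>\<tau>. h (\<sigma>, \<tau>)) q) p = mat_op (emat (ETens e1 e2)) f (LPair p q)" for p q
  proof -
    define P where "P = {\<sigma>. emat e1 p \<sigma> \<noteq> 0}"
    define R where "R = {\<tau>. emat e2 q \<tau> \<noteq> 0}"
    have fin: "finite P" "finite R" using typed_tens.hyps emat_finite_row by (auto simp: P_def R_def)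
    \<comment> \<open>Here \<open>f (\<sigma> ++ \<tau>)\<close> replaces
      \<open>h (\<sigma>, \<tau>)\<close>. Nonzero entries fix the domains of both assignments, so
      wherever the two values could differ the product is 0.\<close>
    define F where "F \<sigma> \<tau> = emat e1 p \<sigma> * emat e2 q \<tau> * f (\<sigma> ++ \<tau>)" for \<sigma> \<tau>
    have F: "\<sigma> \<in> P \<and> \<tau> \<in> R \<and> dom \<sigma> \<subseteq> ?A \<and> dom \<tau> \<subseteq> ?B" if "F \<sigma> \<tau> \<noteq> 0" for \<sigma> \<tau>
      using that emat_support[OF typed_tens.hyps(1), of p \<sigma>] emat_support[OF typed_tens.hyps(2), of q \<tau>]
      by (auto simp: F_def P_def R_def)
    have "den e1 \<Gamma>1 (\<lambda>\<sigma>. den e2 \<Gamma>2 (\<lambda>\<tau>. h (\<sigma>, \<tau>)) q) p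
      = Sum_any (\<lambda>\<sigma>. emat e1 p \<sigma> * Sum_any (\<lambda>\<tau>. emat e2 q \<tau> * h (\<sigma>, \<tau>)))"
      unfolding inner by (subst typed_tens.IH(1)) (auto simp: h_def ctx_split_def mat_op_def)
    also have "\<dots> = Sum_any (\<lambda>\<sigma>. Sum_any (F \<sigma>))"
    proof (rule Sum_any.cong)
      fix \<sigma>
      have "emat e1 p \<sigma> * Sum_any (\<lambda>\<tau>. emat e2 q \<tau> * h (\<sigma>, \<tau>)) =
        Sum_any (\<lambda>\<tau>. emat e1 p \<sigma> * (emat e2 q \<tau> * h (\<sigma>, \<tau>)))"
        by (rule Sum_any_right_distrib) (use fin in \<open>auto simp: R_def elim: rev_finite_subset\<close>)
      also have "\<dots> = Sum_any (F \<sigma>)"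
      proof (rule Sum_any.cong)
        fix \<tau>
        show "emat e1 p \<sigma> * (emat e2 q \<tau> * h (\<sigma>, \<tau>)) = F \<sigma> \<tau>"
          using emat_support[OF typed_tens.hyps(1), of p \<sigma>] emat_support[OF typed_tens.hyps(2), of q \<tau>] h[of \<sigma> \<tau>]
          by (auto simp: F_def)
      qed
      finally show "emat e1 p \<sigma> * Sum_any (\<lambda>\<tau>. emat e2 q \<tau> * h (\<sigma>, \<tau>)) = Sum_any (F \<sigma>)" .
    qed
    also have "\<dots> = Sum_any (\<lambda>\<sigma>. if dom \<sigma> \<subseteq> ?A \<union> ?B then F (\<sigma> |` ?A) (\<sigma> |` ?B) else 0)"
      by (rule Sum_any_map_add[symmetric, OF typed_tens.hyps(3) fin F])
    also have "\<dots> = mat_op (emat (ETens e1 e2)) f (LPair p q)"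
      unfolding mat_op_def
    proof (rule Sum_any.cong)
      fix \<sigma> :: "var \<rightharpoonup> lab"
      have "\<sigma> |` ?A ++ \<sigma> |` ?B = \<sigma>" if "dom \<sigma> \<subseteq> ?A \<union> ?B"
        using that by (rule map_add_restrict)
      thus "(if dom \<sigma> \<subseteq> ?A \<union> ?B then F (\<sigma> |` ?A) (\<sigma> |` ?B) else 0) = emat (ETens e1 e2) (LPair p q) \<sigma> * f \<sigma>"
        by (simp add: fv F_def)
    qed
    finally show ?thesis .
  qed
  hence "pair_lab (tensor_op (den e1 \<Gamma>1) (den e2 \<Gamma>2) h) l = mat_op (emat (ETens e1 e2)) f l" for l
    by (cases l) (auto simp: pair_lab_def tensor_op_def mat_op_def)
  thus ?case
    unfolding den_tens[OF typed_tens.hyps] h_def[symmetric] by (rule ext)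
qed

section \<open>Orthonormality and completeness of syntactic bases\<close>

lemma ONBe_finite: "ONBe Q S \<Longrightarrow> finite S"
  by (induction rule: ONBe.induct) auto

lemma emat_tens:
  assumes "\<sigma> \<in> cbasis (\<Gamma>1 ++ \<Gamma>2)" "typed \<Gamma>1 e1 Q1" "typed \<Gamma>2 e2 Q2"
  shows "emat (ETens e1 e2) (LPair p q) \<sigma> = emat e1 p (\<sigma> |` dom \<Gamma>1) * emat e2 q (\<sigma> |` dom \<Gamma>2)"
  using cbasis_dom[OF assms(1)] typed_fv[OF assms(2)] typed_fv[OF assms(3)] by simp

text \<open>Tensor entries vanish unless the label is a pair, so the sum over labels is a double sum
  of products and factors. The two tensors may live in different contexts.\<close>

lemma emat_tens_orth:
  assumes "\<sigma> \<in> cbasis (\<Gamma>1 ++ \<Gamma>2)" "typed \<Gamma>1 e1 Q1" "typed \<Gamma>2 e2 Q2"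
    and "\<tau> \<in> cbasis (\<Delta>1 ++ \<Delta>2)" "typed \<Delta>1 d1 Q1" "typed \<Delta>2 d2 Q2"
  shows "Sum_any (\<lambda>l. cnj (emat (ETens e1 e2) l \<sigma>) * emat (ETens d1 d2) l \<tau>) =
    Sum_any (\<lambda>p. cnj (emat e1 p (\<sigma> |` dom \<Gamma>1)) * emat d1 p (\<tau> |` dom \<Delta>1)) *
    Sum_any (\<lambda>q. cnj (emat e2 q (\<sigma> |` dom \<Gamma>2)) * emat d2 q (\<tau> |` dom \<Delta>2))"
    (is "_ = Sum_any ?f * Sum_any ?g")
proof -
  define P where "P = {p. emat e1 p (\<sigma> |` dom \<Gamma>1) \<noteq> 0}"
  define R where "R = {q. emat e2 q (\<sigma> |` dom \<Gamma>2) \<noteq> 0}"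
  have fin: "finite P" "finite R" using emat_finite_col assms by (auto simp: P_def R_def)
  have *: "cnj (emat (ETens e1 e2) (LPair p q) \<sigma>) * emat (ETens d1 d2) (LPair p q) \<tau> = ?f p * ?g q" for p q
    unfolding emat_tens[OF assms(1-3)] emat_tens[OF assms(4-6)] by (simp add: mult_ac)
  have "Sum_any (\<lambda>l. cnj (emat (ETens e1 e2) l \<sigma>) * emat (ETens d1 d2) l \<tau>) =
    (\<Sum>l\<in>(\<lambda>(p, q). LPair p q) ` (P \<times> R). cnj (emat (ETens e1 e2) l \<sigma>) * emat (ETens d1 d2) l \<tau>)"
  proof (rule Sum_any.expand_superset)
    show "{l. cnj (emat (ETens e1 e2) l \<sigma>) * emat (ETens d1 d2) l \<tau> \<noteq> 0} \<subseteq> (\<lambda>(p, q). LPair p q) ` (P \<times> R)"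
    proof
      fix l assume l: "l \<in> {l. cnj (emat (ETens e1 e2) l \<sigma>) * emat (ETens d1 d2) l \<tau> \<noteq> 0}"
      then obtain p q where pq: "l = LPair p q" by (cases l) auto
      have "?f p * ?g q \<noteq> 0" using l unfolding pq *[symmetric] by blast
      thus "l \<in> (\<lambda>(p, q). LPair p q) ` (P \<times> R)" by (auto simp: pq P_def R_def)
    qed
  qed (use fin in auto)
  also have "\<dots> = (\<Sum>(p, q)\<in>P \<times> R. ?f p * ?g q)"
    by (subst sum.reindex) (auto simp: inj_on_def * simp del: emat.simps intro!: sum.cong)
  also have "\<dots> = (\<Sum>p\<in>P. ?f p) * (\<Sum>q\<in>R. ?g q)"
    unfolding sum_product by (rule sum.cartesian_product[symmetric])
  also have "(\<Sum>p\<in>P. ?f p) = Sum_any ?f"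
    by (rule Sum_any.expand_superset[symmetric]) (use fin in \<open>auto simp: P_def\<close>)
  also have "(\<Sum>q\<in>R. ?g q) = Sum_any ?g"
    by (rule Sum_any.expand_superset[symmetric]) (use fin in \<open>auto simp: R_def\<close>)
  finally show ?thesis .
qed

text \<open>Matches the delta of a tensor with the product of the deltas of its components. Once the
  components agree, uniqueness of contexts makes both assignments split along the same domains, so
  equal restrictions give equal assignments.\<close>

lemma typed_tens_eq_iff:
  assumes \<sigma>: "\<sigma> \<in> cbasis (\<Gamma>1 ++ \<Gamma>2)" and \<Gamma>: "typed \<Gamma>1 e1 Q1" "typed \<Gamma>2 e2 Q2" "dom \<Gamma>1 \<inter> dom \<Gamma>2 = {}"
    and \<tau>: "\<tau> \<in> cbasis (\<Delta>1 ++ \<Delta>2)" and \<Delta>: "typed \<Delta>1 d1 Q1" "typed \<Delta>2 d2 Q2" "dom \<Delta>1 \<inter> dom \<Delta>2 = {}"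
  shows "ETens e1 e2 = ETens d1 d2 \<and> \<sigma> = \<tau> \<longleftrightarrow>
    (e1 = d1 \<and> \<sigma> |` dom \<Gamma>1 = \<tau> |` dom \<Delta>1) \<and> (e2 = d2 \<and> \<sigma> |` dom \<Gamma>2 = \<tau> |` dom \<Delta>2)"
proof (cases "e1 = d1 \<and> e2 = d2")
  case True
  hence eq: "\<Gamma>1 = \<Delta>1" "\<Gamma>2 = \<Delta>2" using \<Gamma> \<Delta> typed_unique by blast+
  have M: "\<sigma> |` dom \<Gamma>1 ++ \<sigma> |` dom \<Gamma>2 = \<sigma>" "\<tau> |` dom \<Delta>1 ++ \<tau> |` dom \<Delta>2 = \<tau>"
    using \<sigma> \<tau> cbasis_map_add[OF \<Gamma>(3)] cbasis_map_add[OF \<Delta>(3)] by (blast intro: map_add_restrict)+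
  have "\<sigma> = \<tau>" if "\<sigma> |` dom \<Gamma>1 = \<tau> |` dom \<Delta>1" "\<sigma> |` dom \<Gamma>2 = \<tau> |` dom \<Delta>2"
    using M(1)[unfolded that] M(2) by (rule trans[OF sym])
  thus ?thesis using True unfolding eq by blast
qed auto

text \<open>The row counterpart of \<open>emat_tens_orth\<close>: the summation index is now an
  assignment, and disjointness of the contexts allows it to be split into two independent
  ones.\<close>

lemma emat_tens_row:
  assumes "typed \<Gamma>1 e1 Q1" "typed \<Gamma>2 e2 Q2" "dom \<Gamma>1 \<inter> dom \<Gamma>2 = {}"
  shows "Sum_any (\<lambda>\<sigma>. emat (ETens e1 e2) (LPair p q) \<sigma> * cnj (emat (ETens e1 e2) (LPair p' q') \<sigma>)) =
    Sum_any (\<lambda>\<sigma>. emat e1 p \<sigma> * cnj (emat e1 p' \<sigma>)) * Sum_any (\<lambda>\<tau>. emat e2 q \<tau> * cnj (emat e2 q' \<tau>))"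
proof -
  define P where "P = {\<sigma>. emat e1 p \<sigma> \<noteq> 0}"
  define R where "R = {\<tau>. emat e2 q \<tau> \<noteq> 0}"
  have fin: "finite P" "finite R" using emat_finite_row assms by (auto simp: P_def R_def)
  define F where "F \<sigma> \<tau> = (emat e1 p \<sigma> * cnj (emat e1 p' \<sigma>)) * (emat e2 q \<tau> * cnj (emat e2 q' \<tau>))" for \<sigma> \<tau>
  have F: "\<sigma> \<in> P \<and> \<tau> \<in> R \<and> dom \<sigma> \<subseteq> dom \<Gamma>1 \<and> dom \<tau> \<subseteq> dom \<Gamma>2" if "F \<sigma> \<tau> \<noteq> 0" for \<sigma> \<tau>
    using that emat_support[OF assms(1), of p \<sigma>] emat_support[OF assms(2), of q \<tau>]
    by (auto simp: F_def P_def R_def)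
  have "Sum_any (\<lambda>\<sigma>. emat (ETens e1 e2) (LPair p q) \<sigma> * cnj (emat (ETens e1 e2) (LPair p' q') \<sigma>)) =
    Sum_any (\<lambda>\<sigma>. if dom \<sigma> \<subseteq> dom \<Gamma>1 \<union> dom \<Gamma>2 then F (\<sigma> |` dom \<Gamma>1) (\<sigma> |` dom \<Gamma>2) else 0)"
    by (rule Sum_any.cong) (simp add: F_def typed_fv[OF assms(1)] typed_fv[OF assms(2)])
  also have "\<dots> = Sum_any (\<lambda>\<sigma>. Sum_any (F \<sigma>))"
    by (rule Sum_any_map_add[OF assms(3) fin F])
  also have "\<dots> = Sum_any (\<lambda>\<sigma>. emat e1 p \<sigma> * cnj (emat e1 p' \<sigma>)) * Sum_any (\<lambda>\<tau>. emat e2 q \<tau> * cnj (emat e2 q' \<tau>))"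
    unfolding F_def
    by (rule Sum_any_product[symmetric])
      (use fin in \<open>auto simp: P_def R_def elim: rev_finite_subset\<close>)
  finally show ?thesis .
qed

text \<open>Two equal rows would have inner product 1, while distinct indices demand 0. Distinctness
  allows sums over the new basis to be reindexed by \<open>S\<close>.\<close>

lemma lin_rows_inj:
  assumes "finite S" "unitary_matrix_on S \<alpha>"
  shows "inj_on (\<lambda>e. lin S (\<lambda>e'. \<alpha> e e') (\<lambda>e'. e')) S"
proof (rule inj_onI)
  fix e f assume ef: "e \<in> S" "f \<in> S" "lin S (\<lambda>e'. \<alpha> e e') (\<lambda>e'. e') = lin S (\<lambda>e'. \<alpha> f e') (\<lambda>e'. e')"
  hence "set_mset (image_mset (\<lambda>i. (\<alpha> e i, i)) (mset_set S)) = set_mset (image_mset (\<lambda>i. (\<alpha> f i, i)) (mset_set S))"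
    by (simp add: lin_def)
  hence "(\<lambda>i. (\<alpha> e i, i)) ` S = (\<lambda>i. (\<alpha> f i, i)) ` S" using assms(1) by simp
  \<comment> \<open>Each coefficient is paired with its own index, so the set of pairs is the graph
    of the row and determines it.\<close>
  hence "\<alpha> e k = \<alpha> f k" if "k \<in> S" for k using that by (auto simp: set_eq_iff image_iff)
  hence "(\<Sum>k\<in>S. \<alpha> e k * cnj (\<alpha> f k)) = (\<Sum>k\<in>S. \<alpha> e k * cnj (\<alpha> e k))" by simp
  thus "e = f" using assms(2) ef(1,2) by (auto simp: unitary_matrix_on_def split: if_splits)
qed

text \<open>For tensors, one projection of \<open>S\<close> is itself a basis. If the components
  along it differ, their factor is already 0; if they agree, the other two components lie in one
  section, whose hypothesis applies. For linear combinations the sum becomes the inner product of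
  two rows of \<open>\<alpha>\<close>.\<close>

lemma ONBe_orthonormal:
  assumes "ONBe Q S" "s \<in> S" "t \<in> S" "typed \<Gamma> s Q" "typed \<Delta> t Q" "\<sigma> \<in> cbasis \<Gamma>" "\<tau> \<in> cbasis \<Delta>"
  shows "Sum_any (\<lambda>l. cnj (emat s l \<sigma>) * emat t l \<tau>) = (if s = t \<and> \<sigma> = \<tau> then 1 else 0)"
  using assms
proof (induction arbitrary: s t \<Gamma> \<Delta> \<sigma> \<tau> rule: ONBe.induct)
  case (1 Q x)
  have "\<Gamma> = [x \<mapsto> Q]" "\<Delta> = [x \<mapsto> Q]" using 1 by (metis typed_EVarD singletonD)+
  then obtain l k where lk: "\<sigma> = [x \<mapsto> l]" "\<tau> = [x \<mapsto> k]" using 1 by (auto simp only: cbasis_single)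
  have eq: "[x \<mapsto> a] = [x \<mapsto> b] \<longleftrightarrow> a = b" for a b :: lab by (auto dest: map_upd_eqD1)
  have st: "s = EVar x" "t = EVar x" using 1 by auto
  have "Sum_any (\<lambda>j. cnj (emat s j \<sigma>) * emat t j \<tau>) = (\<Sum>j\<in>{l}. cnj (emat s j \<sigma>) * emat t j \<tau>)"
    by (rule Sum_any.expand_superset) (simp_all add: st lk eq subset_iff)
  also have "\<dots> = (if l = k then 1 else 0)" unfolding st lk by (simp add: eq)
  also have "l = k \<longleftrightarrow> s = t \<and> \<sigma> = \<tau>" unfolding st lk eq by simp
  finally show ?case .
next
  case 2
  have "\<sigma> = Map.empty" "\<tau> = Map.empty" using 2 typed_EStarD cbasis_empty by blast+
  moreover have "Sum_any (\<lambda>l. cnj (emat s l \<sigma>) * emat t l \<tau>) = (\<Sum>j\<in>{LUnit}. cnj (emat s j \<sigma>) * emat t j \<tau>)"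
    by (rule Sum_any.expand_superset) (use 2 in \<open>auto split: if_splits\<close>)
  ultimately show ?case using 2 by simp
next
  case (3 Q1 S Q2 T)
  consider (ll) s' t' where "s = EInl s'" "t = EInl t'" "s' \<in> S" "t' \<in> S"
    | (rr) s' t' where "s = EInr s'" "t = EInr t'" "s' \<in> T" "t' \<in> T"
    | (lr) s' t' where "s = EInl s'" "t = EInr t'" | (rl) s' t' where "s = EInr s'" "t = EInl t'"
    using 3(5,6) by blast
  thus ?case
  proof cases
    case ll
    have "typed \<Gamma> s' Q1" "typed \<Delta> t' Q1" using 3(7,8) by (auto simp: ll elim: typed_EInlE)
    moreover have "Sum_any (\<lambda>l. cnj (emat s l \<sigma>) * emat t l \<tau>) =
      Sum_any (\<lambda>p. cnj (emat s (LInl p) \<sigma>) * emat t (LInl p) \<tau>)"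
      by (rule Sum_any_reindex_inj) (auto simp: ll inj_def split: lab.splits)
    ultimately show ?thesis using 3(3)[of s' t' \<Gamma> \<Delta> \<sigma> \<tau>] 3(9,10) ll by simp
  next
    case rr
    have "typed \<Gamma> s' Q2" "typed \<Delta> t' Q2" using 3(7,8) by (auto simp: rr elim: typed_EInrE)
    moreover have "Sum_any (\<lambda>l. cnj (emat s l \<sigma>) * emat t l \<tau>) =
      Sum_any (\<lambda>p. cnj (emat s (LInr p) \<sigma>) * emat t (LInr p) \<tau>)"
      by (rule Sum_any_reindex_inj) (auto simp: rr inj_def split: lab.splits)
    ultimately show ?thesis using 3(4)[of s' t' \<Gamma> \<Delta> \<sigma> \<tau>] 3(9,10) rr by simp
  next
    case lr
    have "cnj (emat s l \<sigma>) * emat t l \<tau> = 0" for l by (cases l) (auto simp: lr)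
    hence "Sum_any (\<lambda>l. cnj (emat s l \<sigma>) * emat t l \<tau>) = 0" by (rule Sum_any_zero)
    moreover have "s \<noteq> t" by (simp add: lr)
    ultimately show ?thesis by (simp only: simp_thms if_False)
  next
    case rl
    have "cnj (emat s l \<sigma>) * emat t l \<tau> = 0" for l by (cases l) (auto simp: rl)
    hence "Sum_any (\<lambda>l. cnj (emat s l \<sigma>) * emat t l \<tau>) = 0" by (rule Sum_any_zero)
    moreover have "s \<noteq> t" by (simp add: rl)
    ultimately show ?thesis by (simp only: simp_thms if_False)
  qed
next
  case (4 S)
  consider (zz) "s = EZero" "t = EZero"
    | (ss) s' t' where "s = ESuc s'" "t = ESuc t'" "s' \<in> S" "t' \<in> S"
    | (zs) t' where "s = EZero" "t = ESuc t'" | (sz) s' where "s = ESuc s'" "t = EZero"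
    using 4(3,4) by blast
  thus ?case
  proof cases
    case zz
    have "\<sigma> = Map.empty" "\<tau> = Map.empty" using 4 zz typed_EZeroD cbasis_empty by blast+
    moreover have "Sum_any (\<lambda>l. cnj (emat s l \<sigma>) * emat t l \<tau>) = (\<Sum>j\<in>{LNat 0}. cnj (emat s j \<sigma>) * emat t j \<tau>)"
      by (rule Sum_any.expand_superset) (use zz in \<open>auto split: if_splits\<close>)
    ultimately show ?thesis using zz by simp
  next
    case ss
    have typed: "typed \<Gamma> s' QNat" "typed \<Delta> t' QNat" using 4(5,6) typed_ESucD by (auto simp: ss)
    have "Sum_any (\<lambda>l. cnj (emat s l \<sigma>) * emat t l \<tau>) =
      Sum_any (\<lambda>n. cnj (emat s (LNat (Suc n)) \<sigma>) * emat t (LNat (Suc n)) \<tau>)"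
      by (rule Sum_any_reindex_inj) (auto simp: ss inj_def split: lab.splits nat.splits)
    also have "\<dots> = Sum_any (\<lambda>n. cnj (emat s' (LNat n) \<sigma>) * emat t' (LNat n) \<tau>)" by (simp add: ss)
    \<comment> \<open>Labels not of the form \<open>LNat n\<close> must contribute nothing. Matrix
      entries ignore types, but at assignments in \<open>cbasis \<Gamma>\<close> the support lemma
      confines the labels to those of qnat.\<close>
    also have "\<dots> = Sum_any (\<lambda>l. cnj (emat s' l \<sigma>) * emat t' l \<tau>)"
    proof (rule Sum_any_reindex_inj[symmetric])
      fix l assume "cnj (emat s' l \<sigma>) * emat t' l \<tau> \<noteq> 0"
      hence "l \<in> qbasis QNat" using emat_support[OF typed(1), of l \<sigma>] 4(7) by auto
      thus "l \<in> range LNat" by simp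
    qed (auto simp: inj_def)
    finally show ?thesis using 4(2)[of s' t' \<Gamma> \<Delta> \<sigma> \<tau>] 4(7,8) ss typed by simp
  next
    case zs
    have "cnj (emat s l \<sigma>) * emat t l \<tau> = 0" for l by (auto simp: zs)
    hence "Sum_any (\<lambda>l. cnj (emat s l \<sigma>) * emat t l \<tau>) = 0" by (rule Sum_any_zero)
    moreover have "s \<noteq> t" by (simp add: zs)
    ultimately show ?thesis by (simp only: simp_thms if_False)
  next
    case sz
    have "cnj (emat s l \<sigma>) * emat t l \<tau> = 0" for l by (auto simp: sz)
    hence "Sum_any (\<lambda>l. cnj (emat s l \<sigma>) * emat t l \<tau>) = 0" by (rule Sum_any_zero)
    moreover have "s \<noteq> t" by (simp add: sz)
    ultimately show ?thesis by (simp only: simp_thms if_False)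
  qed
next
  case (5 S Q2 Q1)
  obtain e1 e2 d1 d2 where e: "s = ETens e1 e2" "t = ETens d1 d2" using 5(2,6,7) by blast
  obtain \<Gamma>1 \<Gamma>2 where \<Gamma>: "\<Gamma> = \<Gamma>1 ++ \<Gamma>2" "typed \<Gamma>1 e1 Q1" "typed \<Gamma>2 e2 Q2" "dom \<Gamma>1 \<inter> dom \<Gamma>2 = {}"
    using 5(8) unfolding e by (auto elim: typed_ETensE)
  obtain \<Delta>1 \<Delta>2 where \<Delta>: "\<Delta> = \<Delta>1 ++ \<Delta>2" "typed \<Delta>1 d1 Q1" "typed \<Delta>2 d2 Q2" "dom \<Delta>1 \<inter> dom \<Delta>2 = {}"
    using 5(9) unfolding e by (auto elim: typed_ETensE)
  note \<sigma>\<tau> = 5(10,11)[unfolded \<Gamma>(1) \<Delta>(1)]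
  have \<sigma>: "\<sigma> |` dom \<Gamma>1 \<in> cbasis \<Gamma>1" "\<sigma> |` dom \<Gamma>2 \<in> cbasis \<Gamma>2"
    using \<sigma>\<tau>(1) cbasis_map_add[OF \<Gamma>(4)] by blast+
  have \<tau>: "\<tau> |` dom \<Delta>1 \<in> cbasis \<Delta>1" "\<tau> |` dom \<Delta>2 \<in> cbasis \<Delta>2"
    using \<sigma>\<tau>(2) cbasis_map_add[OF \<Delta>(4)] by blast+
  have mem: "e2 \<in> eproj2 S" "d2 \<in> eproj2 S" "e1 \<in> esec2 S e2" "d1 \<in> esec2 S d2"
    using 5(6,7) by (auto simp: e eproj2_def esec2_def)
  have "Sum_any (\<lambda>l. cnj (emat e2 l (\<sigma> |` dom \<Gamma>2)) * emat d2 l (\<tau> |` dom \<Delta>2)) =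
    (if e2 = d2 \<and> \<sigma> |` dom \<Gamma>2 = \<tau> |` dom \<Delta>2 then 1 else 0)"
    by (rule 5(4)[OF mem(1,2) \<Gamma>(3) \<Delta>(3) \<sigma>(2) \<tau>(2)])
  moreover have "Sum_any (\<lambda>l. cnj (emat e1 l (\<sigma> |` dom \<Gamma>1)) * emat d1 l (\<tau> |` dom \<Delta>1)) =
    (if e1 = d1 \<and> \<sigma> |` dom \<Gamma>1 = \<tau> |` dom \<Delta>1 then 1 else 0)" if "e2 = d2"
    using bspec[OF 5(5) mem(2)] mem(3,4) \<Gamma>(2) \<Delta>(2) \<sigma>(1) \<tau>(1) unfolding that by blast
  ultimately show ?case
    unfolding e emat_tens_orth[OF \<sigma>\<tau>(1) \<Gamma>(2,3) \<sigma>\<tau>(2) \<Delta>(2,3)] typed_tens_eq_iff[OF \<sigma>\<tau>(1) \<Gamma>(2-4) \<sigma>\<tau>(2) \<Delta>(2-4)]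
    by (cases "e2 = d2") simp_all
next
  case (6 S Q1 Q2)
  obtain e1 e2 d1 d2 where e: "s = ETens e1 e2" "t = ETens d1 d2" using 6(2,6,7) by blast
  obtain \<Gamma>1 \<Gamma>2 where \<Gamma>: "\<Gamma> = \<Gamma>1 ++ \<Gamma>2" "typed \<Gamma>1 e1 Q1" "typed \<Gamma>2 e2 Q2" "dom \<Gamma>1 \<inter> dom \<Gamma>2 = {}"
    using 6(8) unfolding e by (auto elim: typed_ETensE)
  obtain \<Delta>1 \<Delta>2 where \<Delta>: "\<Delta> = \<Delta>1 ++ \<Delta>2" "typed \<Delta>1 d1 Q1" "typed \<Delta>2 d2 Q2" "dom \<Delta>1 \<inter> dom \<Delta>2 = {}"
    using 6(9) unfolding e by (auto elim: typed_ETensE)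
  note \<sigma>\<tau> = 6(10,11)[unfolded \<Gamma>(1) \<Delta>(1)]
  have \<sigma>: "\<sigma> |` dom \<Gamma>1 \<in> cbasis \<Gamma>1" "\<sigma> |` dom \<Gamma>2 \<in> cbasis \<Gamma>2"
    using \<sigma>\<tau>(1) cbasis_map_add[OF \<Gamma>(4)] by blast+
  have \<tau>: "\<tau> |` dom \<Delta>1 \<in> cbasis \<Delta>1" "\<tau> |` dom \<Delta>2 \<in> cbasis \<Delta>2"
    using \<sigma>\<tau>(2) cbasis_map_add[OF \<Delta>(4)] by blast+
  have mem: "e1 \<in> eproj1 S" "d1 \<in> eproj1 S" "e2 \<in> esec1 S e1" "d2 \<in> esec1 S d1"
    using 6(6,7) by (auto simp: e eproj1_def esec1_def)
  have "Sum_any (\<lambda>l. cnj (emat e1 l (\<sigma> |` dom \<Gamma>1)) * emat d1 l (\<tau> |` dom \<Delta>1)) =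
    (if e1 = d1 \<and> \<sigma> |` dom \<Gamma>1 = \<tau> |` dom \<Delta>1 then 1 else 0)"
    by (rule 6(4)[OF mem(1,2) \<Gamma>(2) \<Delta>(2) \<sigma>(1) \<tau>(1)])
  moreover have "Sum_any (\<lambda>l. cnj (emat e2 l (\<sigma> |` dom \<Gamma>2)) * emat d2 l (\<tau> |` dom \<Delta>2)) =
    (if e2 = d2 \<and> \<sigma> |` dom \<Gamma>2 = \<tau> |` dom \<Delta>2 then 1 else 0)" if "e1 = d1"
    using bspec[OF 6(5) mem(2)] mem(3,4) \<Gamma>(3) \<Delta>(3) \<sigma>(2) \<tau>(2) unfolding that by blast
  ultimately show ?case
    unfolding e emat_tens_orth[OF \<sigma>\<tau>(1) \<Gamma>(2,3) \<sigma>\<tau>(2) \<Delta>(2,3)] typed_tens_eq_iff[OF \<sigma>\<tau>(1) \<Gamma>(2-4) \<sigma>\<tau>(2) \<Delta>(2-4)]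
    by (cases "e1 = d1") simp_all
next
  case (7 Q S \<alpha>)
  let ?L = "\<lambda>e. lin S (\<lambda>e'. \<alpha> e e') (\<lambda>e'. e')"
  obtain e f where ef: "e \<in> S" "f \<in> S" "s = ?L e" "t = ?L f" using 7 by blast
  have st: "s = t \<longleftrightarrow> e = f" using lin_rows_inj[OF 7(2,3)] ef by (auto simp: inj_on_def)
  have typed: "\<forall>i\<in>S. typed \<Gamma> i Q" "\<forall>i\<in>S. typed \<Delta> i Q"
    using typed_lin_invert 7 ef by blast+
  have "\<Gamma> = \<Delta>" using typed ef(1) typed_unique by blast
  \<comment> \<open>One finite set of labels serves all members of \<open>S\<close>, so that the
    sums can be exchanged.\<close>
  define H where "H = (\<Union>i\<in>S. {l. emat i l \<sigma> \<noteq> 0})"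
  have H: "finite H" using 7(2) typed emat_finite_col by (auto simp: H_def)
  have IH: "(\<Sum>l\<in>H. cnj (emat i l \<sigma>) * emat j l \<tau>) = (if i = j \<and> \<sigma> = \<tau> then 1 else 0)" if "i \<in> S" "j \<in> S" for i j
  proof -
    have "Sum_any (\<lambda>l. cnj (emat i l \<sigma>) * emat j l \<tau>) = (\<Sum>l\<in>H. cnj (emat i l \<sigma>) * emat j l \<tau>)"
      by (rule Sum_any.expand_superset[OF H]) (use that in \<open>auto simp: H_def\<close>)
    thus ?thesis using 7(4)[of i j \<Gamma> \<Delta> \<sigma> \<tau>] 7(9,10) typed that by simp
  qed
  have "Sum_any (\<lambda>l. cnj (emat s l \<sigma>) * emat t l \<tau>) = (\<Sum>l\<in>H. cnj (emat s l \<sigma>) * emat t l \<tau>)"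
  proof (rule Sum_any.expand_superset[OF H], rule subsetI)
    fix l assume "l \<in> {l. cnj (emat s l \<sigma>) * emat t l \<tau> \<noteq> 0}"
    hence "emat s l \<sigma> \<noteq> 0" by auto
    then obtain i where "i \<in> S" "\<alpha> e i * emat i l \<sigma> \<noteq> 0"
      unfolding ef emat_lin by (rule sum.not_neutral_contains_not_neutral)
    thus "l \<in> H" by (auto simp: H_def)
  qed
  also have "\<dots> = (\<Sum>l\<in>H. \<Sum>i\<in>S. \<Sum>j\<in>S. (cnj (\<alpha> e i) * \<alpha> f j) * (cnj (emat i l \<sigma>) * emat j l \<tau>))"
    unfolding ef emat_lin cnj_sum sum_product by (intro sum.cong refl) simp
  also have "\<dots> = (\<Sum>i\<in>S. \<Sum>j\<in>S. (cnj (\<alpha> e i) * \<alpha> f j) * (\<Sum>l\<in>H. cnj (emat i l \<sigma>) * emat j l \<tau>))"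
    unfolding sum_distrib_left by (subst sum.swap, intro sum.cong refl, subst sum.swap, rule refl)
  also have "\<dots> = (\<Sum>i\<in>S. \<Sum>j\<in>S. if i = j then if \<sigma> = \<tau> then cnj (\<alpha> e i) * \<alpha> f i else 0 else 0)"
    by (intro sum.cong refl) (simp add: IH)
  also have "\<dots> = (\<Sum>i\<in>S. if \<sigma> = \<tau> then cnj (\<alpha> e i) * \<alpha> f i else 0)"
    using 7(2) by simp
  also have "\<dots> = (if \<sigma> = \<tau> then \<Sum>i\<in>S. \<alpha> f i * cnj (\<alpha> e i) else 0)"
    by (simp add: mult.commute)
  also have "\<dots> = (if s = t \<and> \<sigma> = \<tau> then 1 else 0)"
    unfolding st using 7(3) ef(1,2) by (auto simp: unitary_matrix_on_def)
  finally show ?case .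
qed

text \<open>For tensors, summing over a section gives a delta independent of the component indexing
  that section; it factors out and leaves completeness of the projection. For linear combinations
  the sum over the new basis runs down the columns of \<open>\<alpha>\<close>, whose orthonormality
  reduces it to the old basis.\<close>

lemma ONBe_complete:
  assumes "ONBe Q S" "\<And>s. s \<in> S \<Longrightarrow> \<exists>\<Gamma>. typed \<Gamma> s Q" "l \<in> qbasis Q" "m \<in> qbasis Q"
  shows "(\<Sum>s\<in>S. Sum_any (\<lambda>\<sigma>. emat s l \<sigma> * cnj (emat s m \<sigma>))) = (if l = m then 1 else 0)"
  using assms
proof (induction arbitrary: l m rule: ONBe.induct)
  case (1 Q x)
  have eq: "[x \<mapsto> a] = [x \<mapsto> b] \<longleftrightarrow> a = b" for a b :: lab by (auto dest: map_upd_eqD1)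
  have "Sum_any (\<lambda>\<sigma>. emat (EVar x) l \<sigma> * cnj (emat (EVar x) m \<sigma>)) =
    (\<Sum>\<sigma>\<in>{[x \<mapsto> l]}. emat (EVar x) l \<sigma> * cnj (emat (EVar x) m \<sigma>))"
    by (rule Sum_any.expand_superset) (auto split: if_splits)
  also have "\<dots> = (if l = m then 1 else 0)" by (simp add: eq)
  finally show ?case by (simp only: sum.insert_if sum.empty finite.emptyI empty_iff if_False add_0_right)
next
  case 2
  have "Sum_any (\<lambda>\<sigma>. emat EStar l \<sigma> * cnj (emat EStar m \<sigma>)) =
    (\<Sum>\<sigma>\<in>{Map.empty}. emat EStar l \<sigma> * cnj (emat EStar m \<sigma>))"
    by (rule Sum_any.expand_superset) (auto split: if_splits)
  thus ?case using 2 by simp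
next
  case (3 Q1 S Q2 T)
  define r where "r s = Sum_any (\<lambda>\<sigma>. emat s l \<sigma> * cnj (emat s m \<sigma>))" for s
  have S: "\<exists>\<Gamma>. typed \<Gamma> s Q1" if "s \<in> S" for s
    using 3(5)[of "EInl s"] that by (auto elim: typed_EInlE)
  have T: "\<exists>\<Gamma>. typed \<Gamma> s Q2" if "s \<in> T" for s
    using 3(5)[of "EInr s"] that by (auto elim: typed_EInrE)
  have fin: "finite S" "finite T" using 3 ONBe_finite by auto
  have "(\<Sum>s\<in>EInl ` S \<union> EInr ` T. r s) = (\<Sum>s\<in>S. r (EInl s)) + (\<Sum>s\<in>T. r (EInr s))"
    using fin by (subst sum.union_disjoint) (auto simp: sum.reindex inj_on_def)
  also have "\<dots> = (if l = m then 1 else 0)"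
  proof (cases l)
    case (LInl p)
    have T0: "r (EInr s) = 0" for s by (simp add: r_def LInl)
    show ?thesis
    proof (cases m)
      case (LInl p')
      thus ?thesis using 3(3)[OF S, of p p'] 3(6,7) \<open>l = LInl p\<close> by (auto simp: T0) (auto simp: r_def)
    next
      case (LInr p')
      thus ?thesis using \<open>l = LInl p\<close> by (simp add: r_def)
    qed (use 3(7) in auto)
  next
    case (LInr p)
    have S0: "r (EInl s) = 0" for s by (simp add: r_def LInr)
    show ?thesis
    proof (cases m)
      case (LInr p')
      thus ?thesis using 3(4)[OF T, of p p'] 3(6,7) \<open>l = LInr p\<close> by (auto simp: S0) (auto simp: r_def)
    next
      case (LInl p')
      thus ?thesis using \<open>l = LInr p\<close> by (simp add: r_def)
    qed (use 3(7) in auto)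
  qed (use 3(6) in auto)
  finally show ?case by (simp only: r_def)
next
  case (4 S)
  define r where "r s = Sum_any (\<lambda>\<sigma>. emat s l \<sigma> * cnj (emat s m \<sigma>))" for s
  have S: "\<exists>\<Gamma>. typed \<Gamma> s QNat" if "s \<in> S" for s
    using 4(3)[of "ESuc s"] that by (auto dest: typed_ESucD)
  obtain i j where ij: "l = LNat i" "m = LNat j" using 4(4,5) by auto
  have "finite S" using 4 ONBe_finite by auto
  hence "(\<Sum>s\<in>{EZero} \<union> ESuc ` S. r s) = r EZero + (\<Sum>s\<in>S. r (ESuc s))"
    by (subst sum.union_disjoint) (auto simp: sum.reindex inj_on_def)
  also have "r EZero = (if i = 0 \<and> j = 0 then 1 else 0)"
  proof -
    have "r EZero = (\<Sum>\<sigma>\<in>{Map.empty}. emat EZero l \<sigma> * cnj (emat EZero m \<sigma>))"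
      unfolding r_def by (rule Sum_any.expand_superset) (auto split: if_splits)
    thus ?thesis by (simp add: ij)
  qed
  \<comment> \<open>At label 0 the entries of all successors vanish; otherwise both labels are
    shifted down by one and the hypothesis for \<open>S\<close> applies.\<close>
  also have "(\<Sum>s\<in>S. r (ESuc s)) = (if i \<noteq> 0 \<and> i = j then 1 else 0)"
  proof (cases "i = 0 \<or> j = 0")
    case True
    hence "r (ESuc s) = 0" for s by (auto simp: r_def ij)
    thus ?thesis using True by auto
  next
    case False
    then obtain i' j' where "i = Suc i'" "j = Suc j'" by (meson not0_implies_Suc)
    thus ?thesis using 4(2)[OF S, of "LNat i'" "LNat j'"] by (simp add: r_def ij)
  qed
  finally show ?case by (auto simp: r_def ij)
next
  case (5 S Q2 Q1)
  obtain p q where l: "l = LPair p q" "p \<in> qbasis Q1" "q \<in> qbasis Q2" using 5(7) by auto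
  obtain p' q' where m: "m = LPair p' q'" "p' \<in> qbasis Q1" "q' \<in> qbasis Q2" using 5(8) by auto
  define f where "f e = Sum_any (\<lambda>\<sigma>. emat e p \<sigma> * cnj (emat e p' \<sigma>))" for e
  define g where "g e = Sum_any (\<lambda>\<sigma>. emat e q \<sigma> * cnj (emat e q' \<sigma>))" for e
  have typed: "\<exists>\<Gamma>1 \<Gamma>2. typed \<Gamma>1 e1 Q1 \<and> typed \<Gamma>2 e2 Q2 \<and> dom \<Gamma>1 \<inter> dom \<Gamma>2 = {}" if "ETens e1 e2 \<in> S" for e1 e2
    using 5(6)[OF that] by (auto elim!: typed_ETensE)
  have row: "Sum_any (\<lambda>\<sigma>. emat (ETens e1 e2) l \<sigma> * cnj (emat (ETens e1 e2) m \<sigma>)) = f e1 * g e2"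
    if "ETens e1 e2 \<in> S" for e1 e2
    using typed[OF that] emat_tens_row unfolding l m f_def g_def by blast
  \<comment> \<open>\<open>S\<close> is the disjoint union of its sections over the second
    projection. The pairs are written in reverse order because the second component indexes the
    section.\<close>
  have S: "S = (\<lambda>(e2, e1). ETens e1 e2) ` (SIGMA e2:eproj2 S. esec2 S e2)"
    using 5(2) by (force simp: eproj2_def esec2_def)
  have fin: "finite (eproj2 S)" using 5(3) ONBe_finite by blast
  have fin2: "finite (esec2 S e2)" if "e2 \<in> eproj2 S" for e2 using 5(5) that ONBe_finite by blast
  have "(\<Sum>s\<in>S. Sum_any (\<lambda>\<sigma>. emat s l \<sigma> * cnj (emat s m \<sigma>))) = (\<Sum>(e2, e1)\<in>(SIGMA e2:eproj2 S. esec2 S e2). f e1 * g e2)"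
    by (subst S, subst sum.reindex)
      (auto simp: inj_on_def esec2_def row simp del: emat.simps intro!: sum.cong)
  also have "\<dots> = (\<Sum>e2\<in>eproj2 S. \<Sum>e1\<in>esec2 S e2. f e1 * g e2)"
    by (rule sum.Sigma[symmetric]) (use fin fin2 in auto)
  also have "\<dots> = (\<Sum>e2\<in>eproj2 S. (\<Sum>e1\<in>esec2 S e2. f e1) * g e2)"
    by (simp add: sum_distrib_right)
  also have "\<dots> = (\<Sum>e2\<in>eproj2 S. (if p = p' then 1 else 0) * g e2)"
  proof (rule sum.cong[OF refl])
    fix e2 assume e2: "e2 \<in> eproj2 S"
    have "\<And>e1. e1 \<in> esec2 S e2 \<Longrightarrow> \<exists>\<Gamma>. typed \<Gamma> e1 Q1" using typed unfolding esec2_def by blast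
    hence "(\<Sum>e1\<in>esec2 S e2. f e1) = (if p = p' then 1 else 0)"
      unfolding f_def using bspec[OF 5(5) e2] l m by blast
    thus "(\<Sum>e1\<in>esec2 S e2. f e1) * g e2 = (if p = p' then 1 else 0) * g e2" by simp
  qed
  also have "\<dots> = (if p = p' then 1 else 0) * (\<Sum>e2\<in>eproj2 S. g e2)"
    by (rule sum_distrib_left[symmetric])
  also have "(\<Sum>e2\<in>eproj2 S. g e2) = (if q = q' then 1 else 0)"
    unfolding g_def by (rule 5(4)[OF _ l(3) m(3)]) (use typed in \<open>unfold eproj2_def, blast\<close>)
  finally show ?case by (simp add: l m)
next
  case (6 S Q1 Q2)
  obtain p q where l: "l = LPair p q" "p \<in> qbasis Q1" "q \<in> qbasis Q2" using 6(7) by auto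
  obtain p' q' where m: "m = LPair p' q'" "p' \<in> qbasis Q1" "q' \<in> qbasis Q2" using 6(8) by auto
  define f where "f e = Sum_any (\<lambda>\<sigma>. emat e p \<sigma> * cnj (emat e p' \<sigma>))" for e
  define g where "g e = Sum_any (\<lambda>\<sigma>. emat e q \<sigma> * cnj (emat e q' \<sigma>))" for e
  have typed: "\<exists>\<Gamma>1 \<Gamma>2. typed \<Gamma>1 e1 Q1 \<and> typed \<Gamma>2 e2 Q2 \<and> dom \<Gamma>1 \<inter> dom \<Gamma>2 = {}" if "ETens e1 e2 \<in> S" for e1 e2
    using 6(6)[OF that] by (auto elim!: typed_ETensE)
  have row: "Sum_any (\<lambda>\<sigma>. emat (ETens e1 e2) l \<sigma> * cnj (emat (ETens e1 e2) m \<sigma>)) = f e1 * g e2"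
    if "ETens e1 e2 \<in> S" for e1 e2
    using typed[OF that] emat_tens_row unfolding l m f_def g_def by blast
  have S: "S = (\<lambda>(e1, e2). ETens e1 e2) ` (SIGMA e1:eproj1 S. esec1 S e1)"
    using 6(2) by (force simp: eproj1_def esec1_def)
  have fin: "finite (eproj1 S)" using 6(3) ONBe_finite by blast
  have fin2: "finite (esec1 S e1)" if "e1 \<in> eproj1 S" for e1 using 6(5) that ONBe_finite by blast
  have "(\<Sum>s\<in>S. Sum_any (\<lambda>\<sigma>. emat s l \<sigma> * cnj (emat s m \<sigma>))) = (\<Sum>(e1, e2)\<in>(SIGMA e1:eproj1 S. esec1 S e1). f e1 * g e2)"
    by (subst S, subst sum.reindex)
      (auto simp: inj_on_def esec1_def row simp del: emat.simps intro!: sum.cong)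
  also have "\<dots> = (\<Sum>e1\<in>eproj1 S. \<Sum>e2\<in>esec1 S e1. f e1 * g e2)"
    by (rule sum.Sigma[symmetric]) (use fin fin2 in auto)
  also have "\<dots> = (\<Sum>e1\<in>eproj1 S. f e1 * (\<Sum>e2\<in>esec1 S e1. g e2))"
    by (simp add: sum_distrib_left)
  also have "\<dots> = (\<Sum>e1\<in>eproj1 S. f e1 * (if q = q' then 1 else 0))"
  proof (rule sum.cong[OF refl])
    fix e1 assume e1: "e1 \<in> eproj1 S"
    have "\<And>e2. e2 \<in> esec1 S e1 \<Longrightarrow> \<exists>\<Gamma>. typed \<Gamma> e2 Q2" using typed unfolding esec1_def by blast
    hence "(\<Sum>e2\<in>esec1 S e1. g e2) = (if q = q' then 1 else 0)"
      unfolding g_def using bspec[OF 6(5) e1] l m by blast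
    thus "f e1 * (\<Sum>e2\<in>esec1 S e1. g e2) = f e1 * (if q = q' then 1 else 0)" by simp
  qed
  also have "\<dots> = (\<Sum>e1\<in>eproj1 S. f e1) * (if q = q' then 1 else 0)"
    by (rule sum_distrib_right[symmetric])
  also have "(\<Sum>e1\<in>eproj1 S. f e1) = (if p = p' then 1 else 0)"
    unfolding f_def by (rule 6(4)[OF _ l(2) m(2)]) (use typed in \<open>unfold eproj1_def, blast\<close>)
  finally show ?case by (simp add: l m)
next
  case (7 Q S \<alpha>)
  let ?L = "\<lambda>e. lin S (\<lambda>e'. \<alpha> e e') (\<lambda>e'. e')"
  have typed: "\<exists>\<Gamma>. typed \<Gamma> s Q" if "s \<in> S" for s
    using 7(2) 7(5)[of "?L s"] typed_lin_invert that by blast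
  \<comment> \<open>One finite set of assignments serves all members of \<open>S\<close> and all
    their linear combinations, so the four summations can be permuted.\<close>
  define R where "R = (\<Union>i\<in>S. {\<sigma>. emat i l \<sigma> \<noteq> 0})"
  have R: "finite R" unfolding R_def using 7(2) typed emat_finite_row by blast
  have row: "Sum_any (\<lambda>\<sigma>. emat s l \<sigma> * cnj (emat s m \<sigma>)) = (\<Sum>\<sigma>\<in>R. emat s l \<sigma> * cnj (emat s m \<sigma>))"
    if "s \<in> S" for s
    by (rule Sum_any.expand_superset[OF R]) (use that in \<open>auto simp: R_def\<close>)
  have "(\<Sum>s\<in>?L ` S. Sum_any (\<lambda>\<sigma>. emat s l \<sigma> * cnj (emat s m \<sigma>))) =
    (\<Sum>e\<in>S. Sum_any (\<lambda>\<sigma>. emat (?L e) l \<sigma> * cnj (emat (?L e) m \<sigma>)))"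
    by (subst sum.reindex[OF lin_rows_inj[OF 7(2,3)]]) (simp only: comp_def)
  also have "\<dots> = (\<Sum>e\<in>S. \<Sum>\<sigma>\<in>R. emat (?L e) l \<sigma> * cnj (emat (?L e) m \<sigma>))"
  proof (rule sum.cong[OF refl], rule Sum_any.expand_superset[OF R], rule subsetI)
    fix e \<sigma> assume "\<sigma> \<in> {\<sigma>. emat (?L e) l \<sigma> * cnj (emat (?L e) m \<sigma>) \<noteq> 0}"
    hence "emat (?L e) l \<sigma> \<noteq> 0" by auto
    then obtain i where "i \<in> S" "\<alpha> e i * emat i l \<sigma> \<noteq> 0"
      unfolding emat_lin by (rule sum.not_neutral_contains_not_neutral)
    thus "\<sigma> \<in> R" by (auto simp: R_def)
  qed
  also have "\<dots> = (\<Sum>e\<in>S. \<Sum>\<sigma>\<in>R. \<Sum>i\<in>S. \<Sum>j\<in>S. (cnj (\<alpha> e j) * \<alpha> e i) * (emat i l \<sigma> * cnj (emat j m \<sigma>)))"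
    unfolding emat_lin cnj_sum sum_product by (intro sum.cong refl) simp
  also have "\<dots> = (\<Sum>\<sigma>\<in>R. \<Sum>i\<in>S. \<Sum>j\<in>S. \<Sum>e\<in>S. (cnj (\<alpha> e j) * \<alpha> e i) * (emat i l \<sigma> * cnj (emat j m \<sigma>)))"
    by (rule trans[OF sum.swap], rule sum.cong[OF refl], rule trans[OF sum.swap], rule sum.cong[OF refl], rule sum.swap)
  also have "\<dots> = (\<Sum>\<sigma>\<in>R. \<Sum>i\<in>S. \<Sum>j\<in>S. (\<Sum>e\<in>S. cnj (\<alpha> e j) * \<alpha> e i) * (emat i l \<sigma> * cnj (emat j m \<sigma>)))"
    by (simp only: sum_distrib_right)
  also have "\<dots> = (\<Sum>\<sigma>\<in>R. \<Sum>i\<in>S. \<Sum>j\<in>S. if j = i then emat i l \<sigma> * cnj (emat i m \<sigma>) else 0)"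
    using 7(3) by (intro sum.cong refl) (simp add: unitary_matrix_on_def)
  also have "\<dots> = (\<Sum>\<sigma>\<in>R. \<Sum>i\<in>S. emat i l \<sigma> * cnj (emat i m \<sigma>))"
    using 7(2) by simp
  also have "\<dots> = (\<Sum>i\<in>S. \<Sum>\<sigma>\<in>R. emat i l \<sigma> * cnj (emat i m \<sigma>))"
    by (rule sum.swap)
  also have "\<dots> = (\<Sum>i\<in>S. Sum_any (\<lambda>\<sigma>. emat i l \<sigma> * cnj (emat i m \<sigma>)))"
    by (rule sum.cong[OF refl]) (simp only: row)
  also have "\<dots> = (if l = m then 1 else 0)"
    by (rule 7(4)[OF typed 7(6,7)])
  finally show ?case .
qed

section \<open>Interpretation of isomorphisms\<close>

text \<open>\<open>emat\<close> may have entries at assignments that violate the types in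
  \<open>\<Gamma>\<close>. Cutting them off yields the support condition of
  \<open>isometric_matrix\<close> without changing the action on
  \<open>cspace \<Gamma>\<close>.\<close>

definition den_mat :: "ctx \<Rightarrow> expr \<Rightarrow> lab \<Rightarrow> (var \<rightharpoonup> lab) \<Rightarrow> complex" where
  "den_mat \<Gamma> e l \<sigma> = (if \<sigma> \<in> cbasis \<Gamma> then emat e l \<sigma> else 0)"

lemma den_eq_mat_op_den_mat:
  assumes "typed \<Gamma> e Q" "\<And>\<sigma>. \<sigma> \<notin> cbasis \<Gamma> \<Longrightarrow> f \<sigma> = 0"
  shows "den e \<Gamma> f = mat_op (den_mat \<Gamma> e) f"
proof -
  have "(\<lambda>\<sigma>. emat e l \<sigma> * f \<sigma>) = (\<lambda>\<sigma>. den_mat \<Gamma> e l \<sigma> * f \<sigma>)" for l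
    using assms(2) by (auto simp: den_mat_def)
  hence "mat_op (emat e) f = mat_op (den_mat \<Gamma> e) f" unfolding mat_op_def by (simp only:)
  thus ?thesis using den_eq_mat_op[of \<Gamma> e Q f] assms by simp
qed

text \<open>Bases are sets while clauses are indexed: injectivity of \<open>e\<close> turns sums
  over the set into sums over indices and equality of expressions into equality of indices.\<close>

lemma isometric_resolution_ONBe:
  fixes n :: nat
  assumes typed: "\<And>i. i < n \<Longrightarrow> typed (\<Gamma> i) (e i) Q"
    and inj: "inj_on e {..<n}" and ONBe: "ONBe Q (e ` {..<n})"
  shows "isometric_resolution {..<n} (\<lambda>i. cbasis (\<Gamma> i)) (qbasis Q) (\<lambda>i. den_mat (\<Gamma> i) (e i))"
proof -
  have orth: "Sum_any (\<lambda>l. cnj (den_mat (\<Gamma> i) (e i) l \<sigma>) * den_mat (\<Gamma> j) (e j) l \<tau>) = (if i = j \<and> \<sigma> = \<tau> then 1 else 0)"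
    if "i < n" "j < n" "\<sigma> \<in> cbasis (\<Gamma> i)" "\<tau> \<in> cbasis (\<Gamma> j)" for i j \<sigma> \<tau>
  proof -
    have "e i = e j \<longleftrightarrow> i = j" using inj that by (auto simp: inj_on_def)
    thus ?thesis
      using ONBe_orthonormal[OF ONBe _ _ typed typed that(3,4)] that by (simp add: den_mat_def)
  qed
  show ?thesis
  proof (rule isometric_resolution.intro)
    fix i assume "i \<in> {..<n}"
    hence i: "i < n" by simp
    show "isometric_matrix (cbasis (\<Gamma> i)) (qbasis Q) (den_mat (\<Gamma> i) (e i))"
    proof
      show "finite {\<sigma>. den_mat (\<Gamma> i) (e i) l \<sigma> \<noteq> 0}" for l
        by (rule rev_finite_subset[OF emat_finite_row[OF typed[OF i], of l]]) (auto simp: den_mat_def)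
      show "finite {l. den_mat (\<Gamma> i) (e i) l \<sigma> \<noteq> 0}" for \<sigma>
        by (rule rev_finite_subset[OF emat_finite_col[OF typed[OF i], of \<sigma>]]) (auto simp: den_mat_def)
      show "\<sigma> \<in> cbasis (\<Gamma> i) \<and> l \<in> qbasis Q" if "den_mat (\<Gamma> i) (e i) l \<sigma> \<noteq> 0" for l \<sigma>
        using that emat_support[OF typed[OF i], of l \<sigma>] by (auto simp: den_mat_def split: if_splits)
    qed (use orth[OF i i] in simp)
  next
    fix l m assume lm: "l \<in> qbasis Q" "m \<in> qbasis Q"
    \<comment> \<open>Rows at basis labels lose nothing in the truncation, since a nonzero entry
      there already forces the assignment into \<open>cbasis (\<Gamma> i)\<close>.\<close>
    have "den_mat (\<Gamma> i) (e i) k \<sigma> = emat (e i) k \<sigma>" if "i < n" "k \<in> qbasis Q" for i k \<sigma>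
      using emat_support[OF typed[OF that(1)], of k \<sigma>] that(2) by (auto simp: den_mat_def)
    hence "(\<Sum>i<n. Sum_any (\<lambda>\<sigma>. den_mat (\<Gamma> i) (e i) l \<sigma> * cnj (den_mat (\<Gamma> i) (e i) m \<sigma>))) =
      (\<Sum>i<n. Sum_any (\<lambda>\<sigma>. emat (e i) l \<sigma> * cnj (emat (e i) m \<sigma>)))"
      using lm by (intro sum.cong refl) simp
    also have "\<dots> = (\<Sum>s\<in>e ` {..<n}. Sum_any (\<lambda>\<sigma>. emat s l \<sigma> * cnj (emat s m \<sigma>)))"
      by (subst sum.reindex[OF inj]) simp
    also have "\<dots> = (if l = m then 1 else 0)"
      by (rule ONBe_complete[OF ONBe _ lm]) (use typed in blast)
    finally show "(\<Sum>i<n. Sum_any (\<lambda>\<sigma>. den_mat (\<Gamma> i) (e i) l \<sigma> * cnj (den_mat (\<Gamma> i) (e i) m \<sigma>))) = (if l = m then 1 else 0)" .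
  qed (simp_all add: orth)
qed

lemma inj_expr_of: "inj expr_of"
proof (rule injI)
  show "expr_of b = expr_of b' \<Longrightarrow> b = b'" for b b'
    by (induction b arbitrary: b') (case_tac b'; simp)+
qed

text \<open>Every rule for basis values has a counterpart for expressions, and injectivity of
  \<open>expr_of\<close> makes projections and sections commute with the embedding.\<close>

lemma ONBe_expr_of: "ONB Q S \<Longrightarrow> ONBe Q (expr_of ` S)"
proof (induction rule: ONB.induct)
  case (3 Q1 S Q2 T)
  thus ?case using ONBe.intros(3)[of Q1 "expr_of ` S" Q2 "expr_of ` T"] by (simp add: image_Un image_image)
next
  case (4 S)
  thus ?case using ONBe.intros(4)[of "expr_of ` S"] by (simp add: image_image)
next
  case (5 S Q2 Q1)
  have eq: "expr_of b = expr_of b' \<longleftrightarrow> b = b'" for b b' using inj_expr_of by (auto simp: inj_def)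
  have tens: "ETens e e' \<in> expr_of ` S \<longleftrightarrow> (\<exists>b b'. BTens b b' \<in> S \<and> e = expr_of b \<and> e' = expr_of b')" for e e'
    using 5(2) by (force simp: image_iff)
  have proj: "eproj2 (expr_of ` S) = expr_of ` bproj2 S" by (auto simp: eproj2_def bproj2_def tens)
  have sec: "esec2 (expr_of ` S) (expr_of b) = expr_of ` bsec2 S b" for b
    by (auto simp: esec2_def bsec2_def tens eq)
  show ?case
    by (rule ONBe.intros(5)) (use 5 in \<open>force simp: proj sec\<close>)+
next
  case (6 S Q1 Q2)
  have eq: "expr_of b = expr_of b' \<longleftrightarrow> b = b'" for b b' using inj_expr_of by (auto simp: inj_def)
  have tens: "ETens e e' \<in> expr_of ` S \<longleftrightarrow> (\<exists>b b'. BTens b b' \<in> S \<and> e = expr_of b \<and> e' = expr_of b')" for e e'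
    using 6(2) by (force simp: image_iff)
  have proj: "eproj1 (expr_of ` S) = expr_of ` bproj1 S" by (auto simp: eproj1_def bproj1_def tens)
  have sec: "esec1 (expr_of ` S) (expr_of b) = expr_of ` bsec1 S b" for b
    by (auto simp: esec1_def bsec1_def tens eq)
  show ?case
    by (rule ONBe.intros(6)) (use 6 in \<open>force simp: proj sec\<close>)+
qed (auto intro: ONBe.intros)

theorem theorem2p58:
  fixes Q1 Q2 :: qtype and \<Gamma> :: "nat \<Rightarrow> ctx" and n :: nat
    and b :: "nat \<Rightarrow> bval" and e :: "nat \<Rightarrow> expr"
  assumes "iso_typed \<Gamma> n b e Q1 Q2"
  shows "unitary_op (qbasis Q1) (qbasis Q2) (iso_den \<Gamma> n b e Q1)"
proof -
  have b: "typed (\<Gamma> i) (expr_of (b i)) Q1" and e: "typed (\<Gamma> i) (e i) Q2" if "i < n" for i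
    using assms that by (auto simp: iso_typed_def)
  have A: "isometric_resolution {..<n} (\<lambda>i. cbasis (\<Gamma> i)) (qbasis Q2) (\<lambda>i. den_mat (\<Gamma> i) (e i))"
    by (rule isometric_resolution_ONBe) (use assms in \<open>auto simp: iso_typed_def\<close>)
  have B: "isometric_resolution {..<n} (\<lambda>i. cbasis (\<Gamma> i)) (qbasis Q1) (\<lambda>i. den_mat (\<Gamma> i) (expr_of (b i)))"
  proof (rule isometric_resolution_ONBe)
    show "inj_on (\<lambda>i. expr_of (b i)) {..<n}"
      using assms inj_expr_of by (auto simp: iso_typed_def inj_on_def inj_def)
    show "ONBe Q1 ((\<lambda>i. expr_of (b i)) ` {..<n})"
      using assms ONBe_expr_of[of Q1 "b ` {..<n}"] by (simp add: iso_typed_def image_image)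
  qed (use b in auto)
  show ?thesis
  proof (rule unitary_op_resolutions[OF A B])
    fix g assume g: "g \<in> qspace Q1"
    show "iso_den \<Gamma> n b e Q1 g =
      (\<lambda>l. \<Sum>i<n. mat_op (den_mat (\<Gamma> i) (e i)) (mat_op (ctrans (den_mat (\<Gamma> i) (expr_of (b i)))) g) l)"
      unfolding iso_den_def
    proof (intro ext sum.cong refl)
      fix l i assume "i \<in> {..<n}"
      then interpret B: isometric_matrix "cbasis (\<Gamma> i)" "qbasis Q1" "den_mat (\<Gamma> i) (expr_of (b i))"
        by (rule isometric_resolution.iso[OF B])
      have i: "i < n" using \<open>i \<in> {..<n}\<close> by simp
      \<comment> \<open>Members of \<open>cspace (\<Gamma> i)\<close> vanish outside the context
        basis, so there the denotation agrees with its matrix and the abstract adjoint becomes the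
        conjugate transpose. Its values lie in the same space, which lets \<open>e i\<close> be
        replaced by its matrix too.\<close>
      have "adj (cbasis (\<Gamma> i)) (qbasis Q1) (den (expr_of (b i)) (\<Gamma> i)) g = mat_op (ctrans (den_mat (\<Gamma> i) (expr_of (b i)))) g"
        by (rule B.adj_mat_op[OF g], rule den_eq_mat_op_den_mat[OF b[OF i]]) (simp add: ell2D(1))
      thus "den (e i) (\<Gamma> i) (adj (cbasis (\<Gamma> i)) (qbasis Q1) (den (expr_of (b i)) (\<Gamma> i)) g) l =
        mat_op (den_mat (\<Gamma> i) (e i)) (mat_op (ctrans (den_mat (\<Gamma> i) (expr_of (b i)))) g) l"
        using den_eq_mat_op_den_mat[OF e[OF i]] ell2D(1)[OF B.mat_op_ctrans_ell2[OF g]] by simp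
    qed
  qed
qed

end
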